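(* Let $m$ be a positive integer and $k$ a nonnegative integer. The number of self-conjugate $(2m, 2m+1, \ldots, 2m+2k+1)$-core partitions is equal to the number of symmetric $(2m,2k+1)$-Dyck paths.
   Context: A partition $\lambda$ is identified with its Young diagram; its conjugate is the reflection of the diagram in the main diagonal, and $\lambda$ is self-conjugate if it equals its conjugate. The hook length of a box is the number of boxes weakly to its right in its row plus those strictly below it in its column. For a positive integer $t$, $\lambda$ is a $t$-core if no box has hook length divisible by $t$; it is a $(t_1,\ldots,t_r)$-core if it is a $t_i$-core for every $i$. For a positive integer $k$ and $s>0$, an $(s,k)$-Dyck path is a lattice path from $(0,0)$ to $(s,0)$ using up steps $(k/2,1)$, down steps $(k/2,-1)$ and horizontal steps $(\ell,0)$ with $\ell$ an integer, $1\le\ell<k$, never going below the $x$-axis. It is symmetric if its reflection about the line $x=s/2$ is itself. *)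

theory Defs
  imports Complex_Main "HOL-Library.Product_Plus"
begin

definition is_partition :: "nat list \<Rightarrow> bool" where
  "is_partition ps \<longleftrightarrow> sorted_wrt (\<ge>) ps \<and> 0 \<notin> set ps"

(* Boxes are pairs (row, column), both counted from 0, with row 0 on top. *)
definition young :: "nat list \<Rightarrow> (nat \<times> nat) set" where
  "young ps = {(i, j). i < length ps \<and> j < ps ! i}"

definition self_conjugate :: "nat list \<Rightarrow> bool" where
  "self_conjugate ps \<longleftrightarrow> prod.swap ` young ps = young ps"

definition hook_length :: "nat list \<Rightarrow> nat \<times> nat \<Rightarrow> nat" where
  "hook_length ps b =
     card {c \<in> young ps. fst c = fst b \<and> snd c \<ge> snd b} +
     card {c \<in> young ps. snd c = snd b \<and> fst c > fst b}"

definition is_core :: "nat \<Rightarrow> nat list \<Rightarrow> bool" where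
  "is_core t ps \<longleftrightarrow> (\<forall>b \<in> young ps. \<not> t dvd hook_length ps b)"

definition self_conjugate_cores :: "nat set \<Rightarrow> nat list set" where
  "self_conjugate_cores T =
     {ps. is_partition ps \<and> self_conjugate ps \<and> (\<forall>t \<in> T. is_core t ps)}"

definition dyck_steps :: "nat \<Rightarrow> (rat \<times> int) set" where
  "dyck_steps k =
     {(of_nat k / 2, 1), (of_nat k / 2, -1)} \<union> {(of_nat l, 0) | l. 1 \<le> l \<and> l < k}"

(* A path is the list of its successive vertices, so that a horizontal step of
   length 2 and two consecutive horizontal steps of length 1 are distinguished.
   It stays above the axis iff all of its vertices do. *)
definition dyck_path :: "nat \<Rightarrow> nat \<Rightarrow> (rat \<times> int) list \<Rightarrow> bool" where
  "dyck_path s k P \<longleftrightarrow>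
     P \<noteq> [] \<and> hd P = (0, 0) \<and> last P = (of_nat s, 0) \<and>
     successively (\<lambda>p q. q - p \<in> dyck_steps k) P \<and>
     (\<forall>p \<in> set P. snd p \<ge> 0)"

(* Reflection about the vertical line x = s/2; the image is traversed from
   left to right again, hence the reversal. *)
definition reflect_path :: "nat \<Rightarrow> (rat \<times> int) list \<Rightarrow> (rat \<times> int) list" where
  "reflect_path s P = rev (map (\<lambda>(x, y). (of_nat s - x, y)) P)"

definition symmetric_dyck_paths :: "nat \<Rightarrow> nat \<Rightarrow> (rat \<times> int) list set" where
  "symmetric_dyck_paths s k = {P. dyck_path s k P \<and> reflect_path s P = P}"

end

theory Submission
  imports Defs "HOL-Library.Infinite_Set"
begin

text \<open>
  A self-conjugate partition is encoded by its Maya diagram, a set \<open>S\<close> of integers that contains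
  exactly one of \<open>x\<close> and \<open>-1 - x\<close>; it is a \<open>t\<close>-core iff \<open>S - t \<subseteq> S\<close>. Put \<open>K = 2 k + 1\<close>. Closure
  under subtraction of \<open>2 m, \<dots>, 2 m + K\<close> says that the heights \<open>f i\<close> of the columns
  \<open>i + 2 m \<int>\<close> of \<open>S\<close> rise by at most one over every distance up to \<open>K\<close>. By symmetry \<open>f\<close> is
  determined by \<open>f 0, \<dots>, f (m - 1)\<close>, and the conditions on these values can be checked by
  reading them from left to right while remembering only the minimum \<open>v\<close> of the last \<open>K\<close> values
  and the number \<open>j\<close> of values read since it was last attained. Hence the number \<open>A n v\<close> of
  continuations of length \<open>n\<close> satisfies
  \<open>A n v - A n (v - 1) = (\<Sum>l = 1..<K. A (n - l) v) + A (n - K) (v + 1)\<close> up to a source term.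
  In the coordinates \<open>h = v + 1\<close> and \<open>w = 2 n + h K\<close> this is the recurrence that counts symmetric
  paths of width \<open>w\<close> starting at height \<open>h\<close> by their first and last step. If \<open>E w h\<close> is the number
  of these paths, extended to an odd function about \<open>h = -1\<close>, the source terms agree for
  \<open>A n v = E w h - E w (h - 1)\<close>; the theorem is the case \<open>n = m\<close>, \<open>v = -1\<close>.
\<close>

subsection \<open>Maya diagrams of self-conjugate partitions\<close>

definition row :: "nat list \<Rightarrow> nat \<Rightarrow> nat" where
  "row ps i = (if i < length ps then ps ! i else 0)"

text \<open>Rows past the end count as zero, so all sufficiently negative integers are elements
  ("beads"). The shift by \<open>-1\<close> puts the centre of symmetry at -1/2: conjugation becomes
  reflection of \<open>x\<close> to \<open>-1 - x\<close> combined with complementation.\<close>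

definition maya :: "nat list \<Rightarrow> int set" where
  "maya ps = range (\<lambda>i. int (row ps i) - int i - 1)"

lemma young_iff: "(i, j) \<in> young ps \<longleftrightarrow> j < row ps i"
  by (auto simp: young_def row_def)

lemma row_antimono:
  assumes "is_partition ps" "i \<le> j"
  shows "row ps j \<le> row ps i"
  using assms by (cases "i = j") (auto simp: is_partition_def row_def sorted_wrt_iff_nth_less)

lemma row_eventually_0: "length ps \<le> i \<Longrightarrow> row ps i = 0"
  by (simp add: row_def)

lemma self_conjugate_row_iff:
  assumes "self_conjugate ps"
  shows "j < row ps i \<longleftrightarrow> i < row ps j"
proof -
  have "(i, j) \<in> young ps \<longleftrightarrow> (j, i) \<in> young ps"
    using assms unfolding self_conjugate_def by (metis image_eqI swap_simp)
  then show ?thesis by (simp add: young_iff)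
qed

text \<open>Self-conjugacy turns the column length into \<open>row ps j\<close>. In terms of the
  beads \<open>x\<close>, \<open>y\<close> of rows \<open>i\<close>, \<open>j\<close> the hook
  length is \<open>x + y + 1\<close>.\<close>

lemma hook_length_self_conjugate:
  assumes "self_conjugate ps" "(i, j) \<in> young ps"
  shows "int (hook_length ps (i, j)) = int (row ps i) - int j + int (row ps j) - int i - 1"
proof -
  have "{c \<in> young ps. fst c = i \<and> snd c \<ge> j} = Pair i ` {j..<row ps i}"
    by (auto simp: young_iff)
  then have arm: "card {c \<in> young ps. fst c = i \<and> snd c \<ge> j} = row ps i - j"
    by (simp add: card_image inj_on_def)
  have "{c \<in> young ps. snd c = j \<and> fst c > i} = (\<lambda>r. (r, j)) ` {i<..<row ps j}"
    by (auto simp: young_iff self_conjugate_row_iff[OF assms(1)])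
  then have leg: "card {c \<in> young ps. snd c = j \<and> fst c > i} = row ps j - Suc i"
    by (simp add: card_image inj_on_def)
  have "j < row ps i" "i < row ps j"
    using assms by (auto simp: young_iff self_conjugate_row_iff[OF assms(1)])
  then show ?thesis
    unfolding hook_length_def using arm leg by simp
qed

lemma maya_symmetric:
  assumes ps: "is_partition ps" and sc: "self_conjugate ps"
  shows "-1 - x \<in> maya ps \<longleftrightarrow> x \<notin> maya ps"
proof
  assume "-1 - x \<in> maya ps"
  then obtain j where j: "-1 - x = int (row ps j) - int j - 1" by (auto simp: maya_def)
  show "x \<notin> maya ps"
  proof
    assume "x \<in> maya ps"
    then obtain i where "x = int (row ps i) - int i - 1" by (auto simp: maya_def)
    \<comment> \<open>The two equations add up to
      \<open>(row ps i - j) + (row ps j - i) = 1\<close>, but by self-conjugacy the summands are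
      both positive or both nonpositive.\<close>
    with j self_conjugate_row_iff[OF sc, of j i] show False by linarith
  qed
next
  assume x: "x \<notin> maya ps"
  \<comment> \<open>\<open>P i\<close> says that the bead of row \<open>i\<close> lies below
    \<open>x\<close>. For the first such row, the gap \<open>x\<close> is the horizontal boundary
    step of column \<open>j = x + i\<close>, and that column has length \<open>i\<close>.\<close>
  define P where "P i \<longleftrightarrow> int (row ps i) - int i \<le> x" for i
  have "P (length ps + nat (- x))"
    unfolding P_def by (simp add: row_eventually_0)
  then have least: "P (Least P)" by (rule LeastI)
  define i where "i = Least P"
  define j where "j = nat (x + int i)"
  have j: "int j = x + int i" "row ps i \<le> j"
    using least unfolding P_def i_def j_def by linarith+
  have "row ps j = i"
  proof (cases i)
    case 0
    then show ?thesis
      using self_conjugate_row_iff[OF sc, of j i] j by auto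
  next
    case (Suc i')
    then have "\<not> P i'" unfolding i_def by (metis lessI not_less_Least)
    then have "j \<le> row ps i'" unfolding P_def using j Suc by linarith
    moreover have "row ps i' \<noteq> j"
    proof
      assume "row ps i' = j"
      then have "x = int (row ps i') - int i' - 1" using j Suc by simp
      then show False using x by (auto simp: maya_def)
    qed
    ultimately have "j < row ps i'" by simp
    then show ?thesis
      using self_conjugate_row_iff[OF sc, of j i'] self_conjugate_row_iff[OF sc, of j i] Suc j(2)
      by simp
  qed
  then have "-1 - x = int (row ps j) - int j - 1" using j(1) by simp
  then show "-1 - x \<in> maya ps" by (auto simp: maya_def)
qed

text \<open>By \<open>maya_symmetric\<close>, a bead \<open>x\<close> with a gap at
  \<open>x - t\<close> amounts to two beads \<open>x\<close>, \<open>y\<close> with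
  \<open>x + y + 1 = t\<close>, which is a hook of length \<open>t\<close>. Conversely, a hook
  length \<open>t * n\<close> yields a gap \<open>n\<close> steps of size \<open>t\<close> below a
  bead, which closure forbids.\<close>

lemma is_core_iff_maya:
  assumes ps: "is_partition ps" and sc: "self_conjugate ps" and "t > 0"
  shows "is_core t ps \<longleftrightarrow> (\<forall>x \<in> maya ps. x - int t \<in> maya ps)"
proof
  assume core: "is_core t ps"
  show "\<forall>x \<in> maya ps. x - int t \<in> maya ps"
  proof (rule ccontr)
    assume "\<not> (\<forall>x \<in> maya ps. x - int t \<in> maya ps)"
    then obtain x where x: "x \<in> maya ps" "x - int t \<notin> maya ps" by blast
    then have "-1 - (x - int t) \<in> maya ps" using maya_symmetric[OF ps sc] by blast
    then obtain i j where i: "x = int (row ps i) - int i - 1"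
      and j: "-1 - (x - int t) = int (row ps j) - int j - 1"
      using x(1) by (auto simp: maya_def)
    have "j < row ps i"
      using i j \<open>t > 0\<close> self_conjugate_row_iff[OF sc, of j i] by linarith
    then have box: "(i, j) \<in> young ps" by (simp add: young_iff)
    have "int (hook_length ps (i, j)) = int t"
      using hook_length_self_conjugate[OF sc box] i j by simp
    then show False using core box by (auto simp: is_core_def)
  qed
next
  assume closed: "\<forall>x \<in> maya ps. x - int t \<in> maya ps"
  have closed': "x - int t * int n \<in> maya ps" if "x \<in> maya ps" for x n
    using that
  proof (induction n)
    case (Suc n)
    then have "x - int t * int n - int t \<in> maya ps" using closed by blast
    then show ?case by (simp add: algebra_simps)
  qed simp
  show "is_core t ps"
    unfolding is_core_def
  proof (rule ballI, rule notI)
    fix b assume b: "b \<in> young ps" "t dvd hook_length ps b"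
    obtain i j where ij: "b = (i, j)" by fastforce
    obtain n where n: "hook_length ps b = t * n" using b(2) by (auto elim: dvdE)
    have "int (row ps i) - int i - 1 - int t * int n \<in> maya ps"
      by (rule closed') (auto simp: maya_def)
    moreover have "int (row ps i) - int i - 1 - int t * int n = -1 - (int (row ps j) - int j - 1)"
      using hook_length_self_conjugate[OF sc, of i j] b ij n by simp
    ultimately have "int (row ps j) - int j - 1 \<notin> maya ps"
      using maya_symmetric[OF ps sc] by metis
    then show False by (auto simp: maya_def)
  qed
qed

lemma maya_bounded:
  assumes "is_partition ps"
  shows "bdd_above (maya ps)"
proof
  fix x assume "x \<in> maya ps"
  then obtain i where "x = int (row ps i) - int i - 1" by (auto simp: maya_def)
  then show "x \<le> int (row ps 0)"
    using row_antimono[OF assms, of 0 i] by simp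
qed

lemma strict_mono_range_unique:
  fixes f g :: "nat \<Rightarrow> 'a::linorder"
  assumes "strict_mono f" "strict_mono g" "range f = range g"
  shows "f = g"
proof
  show "f n = g n" for n
  proof (induction n rule: less_induct)
    case (less n)
    obtain i where i: "f n = g i" using assms(3) by (metis rangeE rangeI)
    obtain j where j: "g n = f j" using assms(3) by (metis rangeE rangeI)
    have "i \<ge> n" "j \<ge> n"
      using less i j assms(1,2) by (metis less_irrefl linorder_not_le strict_mono_less)+
    then have "g n \<le> f n" "f n \<le> g n"
      using i j assms(1,2) by (metis strict_mono_less_eq)+
    then show ?case by simp
  qed
qed

text \<open>Beads strictly decrease with the row index, so their set determines each row; as parts
  are positive, the rows determine the length.\<close>

lemma maya_inj: "inj_on maya {ps. is_partition ps}"
proof (rule inj_onI; clarify)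
  fix ps qs assume ps: "is_partition ps" and qs: "is_partition qs" and eq: "maya ps = maya qs"
  define f where "f rs i = int i + 1 - int (row rs i)" for rs i
  have mono: "strict_mono (f rs)" if "is_partition rs" for rs
  proof -
    have "row rs (Suc n) \<le> row rs n" for n
      using row_antimono[OF that, of n "Suc n"] by simp
    then show ?thesis
      unfolding strict_mono_Suc_iff f_def by (smt (verit) of_nat_Suc of_nat_mono)
  qed
  have range: "range (f rs) = uminus ` maya rs" for rs
    unfolding f_def maya_def image_image by (simp add: algebra_simps)
  have "f ps = f qs"
    using mono[OF ps] mono[OF qs] range eq by (metis strict_mono_range_unique)
  have row: "row ps i = row qs i" for i
    using fun_cong[OF \<open>f ps = f qs\<close>, of i] by (simp add: f_def)
  have pos: "row rs i > 0 \<longleftrightarrow> i < length rs" if "is_partition rs" for rs i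
    using that by (auto simp: is_partition_def row_def) (metis neq0_conv nth_mem)
  have "length ps = length qs"
    using pos[OF ps] pos[OF qs] row by (metis less_irrefl linorder_neqE_nat)
  then show "ps = qs"
    using row by (metis nth_equalityI row_def)
qed

section \<open>From symmetric sets of integers back to partitions\<close>

lemma card_symmetric_interval:
  fixes S :: "int set"
  assumes sym: "\<And>x. -1 - x \<in> S \<longleftrightarrow> x \<notin> S"
  shows "card (S \<inter> {- int n..<int n}) = n"
proof (induction n)
  case (Suc n)
  have "{- int (Suc n)..<int (Suc n)} = insert (-1 - int n) (insert (int n) {- int n..<int n})"
    by auto
  then have "S \<inter> {- int (Suc n)..<int (Suc n)} =
      insert (if int n \<in> S then int n else -1 - int n) (S \<inter> {- int n..<int n})"
    using sym[of "int n"] by auto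
  then show ?case using Suc by simp
qed simp

text \<open>A set that contains exactly one of \<open>x\<close> and \<open>-1 - x\<close> has charge zero, so the rows of the
  partition read off from its decreasing enumeration end in zeros.\<close>

lemma card_atLeast_symmetric:
  fixes S :: "int set"
  assumes sym: "\<And>x. -1 - x \<in> S \<longleftrightarrow> x \<notin> S" and bdd: "bdd_above S" and x: "x \<in> S"
  shows "int (card (S \<inter> {-x..})) = x + int (card (S \<inter> {x<..})) + 1"
proof -
  obtain N where N: "\<And>y. y \<in> S \<Longrightarrow> y \<le> N" using bdd by (auto simp: bdd_above_def)
  have fin: "finite (S \<inter> {y..})" "finite (S \<inter> {y<..})" for y
    by (rule finite_subset[of _ "{y..N}"]; use N in auto)+
  show ?thesis
  proof (cases "x \<ge> 0")
    case True
    then obtain n where n: "x = int n" using nonneg_int_cases by blast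
    have "S \<inter> {-x..} = insert x ((S \<inter> {- int n..<int n}) \<union> (S \<inter> {x<..}))"
      using x n by auto
    also have "card \<dots> = Suc (card ((S \<inter> {- int n..<int n}) \<union> (S \<inter> {x<..})))"
      using fin n by (subst card_insert_disjoint) auto
    also have "card ((S \<inter> {- int n..<int n}) \<union> (S \<inter> {x<..})) = n + card (S \<inter> {x<..})"
      using fin n by (subst card_Un_disjoint) (auto simp: card_symmetric_interval[OF sym])
    finally show ?thesis using n by simp
  next
    case False
    define n where "n = nat (-x - 1)"
    have n: "x = -1 - int n" using False by (simp add: n_def)
    have "int n \<notin> S" using sym[of "int n"] x n by simp
    then have "y \<noteq> int n" if "y \<in> S" for y using that by metis
    then have "S \<inter> {x<..} = (S \<inter> {- int n..<int n}) \<union> (S \<inter> {-x..})"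
      using n by (fastforce simp: order.order_iff_strict)
    also have "card \<dots> = n + card (S \<inter> {-x..})"
      using fin n by (subst card_Un_disjoint) (auto simp: card_symmetric_interval[OF sym])
    finally show ?thesis using n by simp
  qed
qed

lemma decreasing_enumeration:
  fixes S :: "int set"
  assumes sym: "\<And>x. -1 - x \<in> S \<longleftrightarrow> x \<notin> S" and N: "\<And>x. x \<in> S \<Longrightarrow> x \<le> N"
  obtains s :: "nat \<Rightarrow> int"
  where "range s = S" "\<And>i j. i < j \<Longrightarrow> s j < s i" "\<And>i. s i \<le> N - int i"
proof -
  define T where "T = {n. N - int n \<in> S}"
  have "infinite T"
    unfolding infinite_nat_iff_unbounded
  proof
    fix b
    define n where "n = Suc b + nat (2 * N + 2)"
    have "-1 - (N - int n) > N" unfolding n_def by linarith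
    then have "-1 - (N - int n) \<notin> S" using N by (metis linorder_not_le)
    then have "n \<in> T" unfolding T_def using sym[of "N - int n"] by simp
    then show "\<exists>n>b. n \<in> T" unfolding n_def by (intro exI[of _ n]) (simp add: n_def)
  qed
  define s where "s i = N - int (enumerate T i)" for i
  have "range s = (\<lambda>n. N - int n) ` T"
    unfolding s_def using range_enumerate[OF \<open>infinite T\<close>] by (metis image_image)
  also have "\<dots> = S"
  proof -
    have "x \<in> (\<lambda>n. N - int n) ` T" if "x \<in> S" for x
      using N[OF that] that by (intro image_eqI[of _ _ "nat (N - x)"]) (auto simp: T_def)
    then show ?thesis by (auto simp: T_def)
  qed
  finally have "range s = S" .
  moreover have "s j < s i" if "i < j" for i j
    using enumerate_mono[OF that \<open>infinite T\<close>] by (simp add: s_def)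
  moreover have "s i \<le> N - int i" for i
    using le_enumerate[OF \<open>infinite T\<close>] by (simp add: s_def)
  ultimately show ?thesis by (rule that)
qed

lemma maya_surj:
  fixes S :: "int set"
  assumes sym: "\<And>x. -1 - x \<in> S \<longleftrightarrow> x \<notin> S" and bdd: "bdd_above S"
  obtains ps where "is_partition ps" "self_conjugate ps" "maya ps = S"
proof -
  obtain N where N: "\<And>y. y \<in> S \<Longrightarrow> y \<le> N" using bdd by (auto simp: bdd_above_def)
  obtain s where s: "range s = S" "\<And>i j. i < j \<Longrightarrow> s j < s i" "\<And>i. s i \<le> N - int i"
    using decreasing_enumeration[OF sym N] by metis
  have s_iff: "s j < s i \<longleftrightarrow> i < j" for i j
    using s(2) by (metis less_asym linorder_neqE_nat less_irrefl)
  \<comment> \<open>The hook length at \<open>(i, j)\<close> has to be \<open>s i + s j + 1\<close>,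
    so this counts the boxes of row \<open>i\<close>. The condition is symmetric in \<open>i\<close>
    and \<open>j\<close>, which builds in self-conjugacy.\<close>
  define p where "p i = card {j. 0 \<le> s i + s j}" for i
  have inj: "inj_on s A" for A
    by (rule inj_onI) (metis s_iff linorder_neqE_nat less_irrefl)
  have p: "int (p i) = s i + int i + 1" for i
  proof -
    \<comment> \<open>Through \<open>s\<close>, \<open>p i\<close> counts the elements of
      \<open>S\<close> from \<open>- s i\<close> upwards and \<open>i\<close> counts those above
      \<open>s i\<close>; \<open>card_atLeast_symmetric\<close> compares the two.\<close>
    have "s ` {j. 0 \<le> s i + s j} = S \<inter> {- s i..}" using s(1) by auto
    then have "p i = card (S \<inter> {- s i..})" unfolding p_def using card_image[OF inj] by metis
    moreover have "s ` {..<i} = S \<inter> {s i<..}" using s(1) s_iff by auto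
    then have "i = card (S \<inter> {s i<..})" using card_image[OF inj] by (metis card_lessThan)
    ultimately show ?thesis
      using card_atLeast_symmetric[OF sym bdd, of "s i"] s(1) by auto
  qed
  have fin: "finite {j. 0 \<le> s i + s j}" for i
  proof (rule finite_subset)
    show "{j. 0 \<le> s i + s j} \<subseteq> {..nat (s i + N)}"
    proof safe
      fix j assume "0 \<le> s i + s j"
      then show "j \<le> nat (s i + N)" using s(3)[of j] by linarith
    qed
  qed simp
  have less_p: "j < p i \<longleftrightarrow> 0 \<le> s i + s j" for i j
  proof
    assume "0 \<le> s i + s j"
    moreover have "s j \<le> s j'" if "j' \<le> j" for j'
      using that s(2) by (metis less_imp_le order.order_iff_strict)
    ultimately have "{..j} \<subseteq> {j. 0 \<le> s i + s j}" by fastforce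
    from card_mono[OF fin this] show "j < p i" by (simp add: p_def)
  next
    assume "j < p i"
    show "0 \<le> s i + s j"
    proof (rule ccontr)
      assume neg: "\<not> 0 \<le> s i + s j"
      have "{j. 0 \<le> s i + s j} \<subseteq> {..<j}"
      proof safe
        fix j' assume "0 \<le> s i + s j'"
        then have "s j < s j'" using neg by linarith
        then show "j' < j" by (simp add: s_iff)
      qed
      from card_mono[OF _ this] show False using \<open>j < p i\<close> by (simp add: p_def)
    qed
  qed
  have less_p_commute: "j < p i \<longleftrightarrow> i < p j" for i j
    by (simp add: less_p add.commute)
  have mono: "p j \<le> p i" if "i \<le> j" for i j
    by (metis less_p_commute linorder_not_less that dual_order.strict_trans2 less_irrefl)
  \<comment> \<open>\<open>0 < p (p 0)\<close> would mean \<open>p 0 < p 0\<close>. Hence the list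
    needs only the first \<open>p 0\<close> rows.\<close>
  have "p (p 0) = 0"
    using less_p_commute[of 0 "p 0"] by simp
  define ps where "ps = map p [0..<p 0]"
  have row: "row ps i = p i" for i
    using mono[of "p 0" i] \<open>p (p 0) = 0\<close> by (auto simp: row_def ps_def)
  have "p i \<noteq> 0" if "i < p 0" for i
    using that less_p_commute[of i 0] by simp
  then have "is_partition ps"
    using mono unfolding is_partition_def ps_def
    by (auto simp: sorted_wrt_iff_nth_less image_iff)
  moreover have "self_conjugate ps"
  proof -
    have "(i, j) \<in> young ps \<longleftrightarrow> (j, i) \<in> young ps" for i j
      unfolding young_iff row by (rule less_p_commute)
    then show ?thesis unfolding self_conjugate_def by force
  qed
  moreover have "maya ps = S"
    unfolding maya_def row p s(1)[symmetric] by simp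
  ultimately show ?thesis by (rule that)
qed

subsection \<open>Column heights\<close>

definition symmetric_maya :: "nat set \<Rightarrow> int set set" where
  "symmetric_maya T = {S. bdd_above S \<and> (\<forall>x. -1 - x \<in> S \<longleftrightarrow> x \<notin> S) \<and>
     (\<forall>t \<in> T. \<forall>x \<in> S. x - int t \<in> S)}"

lemma bij_betw_maya:
  assumes "0 \<notin> T"
  shows "bij_betw maya (self_conjugate_cores T) (symmetric_maya T)"
  unfolding bij_betw_def
proof
  show "inj_on maya (self_conjugate_cores T)"
    using maya_inj by (rule inj_on_subset) (auto simp: self_conjugate_cores_def)
  have core: "(\<forall>t\<in>T. is_core t ps) \<longleftrightarrow> (\<forall>t\<in>T. \<forall>x\<in>maya ps. x - int t \<in> maya ps)"
    if "is_partition ps" "self_conjugate ps" for ps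
    using is_core_iff_maya[OF that] assms by (metis gr0I)
  show "maya ` self_conjugate_cores T = symmetric_maya T"
  proof (intro equalityI subsetI)
    fix S assume "S \<in> maya ` self_conjugate_cores T"
    then obtain ps where ps: "is_partition ps" "self_conjugate ps" "\<forall>t\<in>T. is_core t ps"
      and S: "S = maya ps" by (auto simp: self_conjugate_cores_def)
    show "S \<in> symmetric_maya T"
      unfolding symmetric_maya_def S mem_Collect_eq
      using maya_bounded[OF ps(1)] maya_symmetric[OF ps(1,2)] core[OF ps(1,2)] ps(3) by blast
  next
    fix S assume S: "S \<in> symmetric_maya T"
    then have "bdd_above S" "\<And>x. -1 - x \<in> S \<longleftrightarrow> x \<notin> S"
      by (simp_all add: symmetric_maya_def)
    then obtain ps where ps: "is_partition ps" "self_conjugate ps" "maya ps = S"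
      using maya_surj[of S] by metis
    then have "ps \<in> self_conjugate_cores T"
      using core[OF ps(1,2)] S by (auto simp: symmetric_maya_def self_conjugate_cores_def)
    then show "S \<in> maya ` self_conjugate_cores T" using ps(3) by blast
  qed
qed

text \<open>The value of a profile at \<open>i\<close> is the largest \<open>n\<close> such that \<open>i + 2 m n\<close> belongs to the
  Maya diagram; thus the diagram consists of the places where its profile is nonnegative.\<close>

definition profiles :: "nat \<Rightarrow> nat \<Rightarrow> (int \<Rightarrow> int) set" where
  "profiles m K = {f. (\<forall>i. f (i + 2 * int m) = f i - 1) \<and> (\<forall>i. f (-1 - i) = -1 - f i) \<and>
     (\<forall>p q. p < q \<longrightarrow> q \<le> p + int K \<longrightarrow> f q \<le> f p + 1)}"

lemma quasi_periodic:
  fixes f :: "int \<Rightarrow> int"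
  assumes "\<And>i. f (i + M) = f i - 1"
  shows "f (i + M * n) = f i - n"
proof -
  have *: "f (i + M * int k) = f i - int k" for i k
  proof (induction k)
    case (Suc k)
    then show ?case using assms[of "i + M * int k"] by (simp add: algebra_simps)
  qed simp
  show ?thesis
  proof (cases "n \<ge> 0")
    case True
    then show ?thesis using *[of i "nat n"] by simp
  next
    case False
    then show ?thesis using *[of "i + M * n" "nat (-n)"] by simp
  qed
qed

text \<open>Closure under subtracting \<open>2 * m\<close> makes each residue class a down-set,
  recorded by its top. Closure under subtracting \<open>2 * m + d\<close> compares the columns of
  \<open>p\<close> and \<open>p + d\<close> and becomes
  \<open>f (p + d) \<le> f p + 1\<close>.\<close>

lemma bij_betw_profiles_maya:
  assumes m: "m > 0"
  shows "bij_betw (\<lambda>f. {x. 0 \<le> f x}) (profiles m K) (symmetric_maya {2 * m..2 * m + K})"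
  unfolding bij_betw_def
proof
  show "inj_on (\<lambda>f. {x. 0 \<le> f x}) (profiles m K)"
  proof (rule inj_onI, rule ext)
    fix f g i
    assume "f \<in> profiles m K" "g \<in> profiles m K" and eq: "{x. 0 \<le> f x} = {x. 0 \<le> g x}"
    then have "f (i + 2 * int m * n) = f i - n" "g (i + 2 * int m * n) = g i - n" for n
      by (auto simp: profiles_def intro!: quasi_periodic)
    moreover have "0 \<le> f x \<longleftrightarrow> 0 \<le> g x" for x using eq by blast
    ultimately have "n \<le> f i \<longleftrightarrow> n \<le> g i" for n by (metis diff_ge_0_iff_ge)
    then show "f i = g i" by (metis order_antisym order_refl)
  qed
  show "(\<lambda>f. {x. 0 \<le> f x}) ` profiles m K = symmetric_maya {2 * m..2 * m + K}"
  proof (intro equalityI subsetI)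
    fix S assume "S \<in> (\<lambda>f. {x. 0 \<le> f x}) ` profiles m K"
    then obtain f where S: "S = {x. 0 \<le> f x}" and f: "f \<in> profiles m K" by blast
    have per: "f (i + 2 * int m * n) = f i - n" for i n
      using f by (auto simp: profiles_def intro!: quasi_periodic)
    have win: "f q \<le> f p + 1" if "p \<le> q" "q \<le> p + int K" for p q
      using f that by (cases "p = q") (auto simp: profiles_def)
    have "bdd_above S"
    proof
      fix x assume "x \<in> S"
      define r where "r = x mod (2 * int m)"
      have r: "r \<in> {0..<2 * int m}" using m by (simp add: r_def)
      have "f x = f r - x div (2 * int m)"
        using per[of r "x div (2 * int m)"] by (simp add: r_def)
      then have "x div (2 * int m) \<le> f r" using \<open>x \<in> S\<close> S by simp
      also have "f r \<le> Max (f ` {0..<2 * int m})" using r by simp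
      finally have "2 * int m * (x div (2 * int m)) \<le> 2 * int m * Max (f ` {0..<2 * int m})"
        using m by simp
      moreover have "x = 2 * int m * (x div (2 * int m)) + r" by (simp add: r_def)
      ultimately show "x \<le> 2 * int m * Max (f ` {0..<2 * int m}) + 2 * int m"
        using r by (smt (verit) atLeastLessThan_iff)
    qed
    moreover have "-1 - x \<in> S \<longleftrightarrow> x \<notin> S" for x
    proof -
      have "f (-1 - x) = -1 - f x" using f by (simp add: profiles_def)
      then show ?thesis by (auto simp: S)
    qed
    moreover have "x - int t \<in> S" if "x \<in> S" "t \<in> {2 * m..2 * m + K}" for x t
    proof -
      have "f x \<le> f (x - int t + 2 * int m) + 1"
        by (rule win) (use that in auto)
      also have "\<dots> = f (x - int t)" using f by (simp add: profiles_def)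
      finally show ?thesis using that by (simp add: S)
    qed
    ultimately show "S \<in> symmetric_maya {2 * m..2 * m + K}"
      by (simp add: symmetric_maya_def)
  next
    fix S assume "S \<in> symmetric_maya {2 * m..2 * m + K}"
    then have bdd: "bdd_above S" and sym: "\<And>x. -1 - x \<in> S \<longleftrightarrow> x \<notin> S"
      and closed: "\<And>t x. t \<in> {2 * m..2 * m + K} \<Longrightarrow> x \<in> S \<Longrightarrow> x - int t \<in> S"
      by (simp_all add: symmetric_maya_def)
    obtain N where N: "\<And>x. x \<in> S \<Longrightarrow> x \<le> N" using bdd by (auto simp: bdd_above_def)
    have down1: "i + 2 * int m * n - 2 * int m \<in> S" if "i + 2 * int m * n \<in> S" for i n
      using closed[of "2 * m", OF _ that] by simp
    have down: "i + 2 * int m * n' \<in> S" if "i + 2 * int m * n \<in> S" "n' \<le> n" for i n n'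
      using that(2,1)
    proof (induction n' rule: int_le_induct)
      case (step n')
      then show ?case using down1[of i n'] by (simp add: algebra_simps)
    qed
    have "\<exists>h. \<forall>n. i + 2 * int m * n \<in> S \<longleftrightarrow> n \<le> h" for i
    proof -
      define A where "A = {n. i + 2 * int m * n \<in> S}"
      \<comment> \<open>Large enough that moving \<open>i\<close> by \<open>B\<close> periods up, or
        by \<open>B\<close> periods down and then reflecting, leads beyond \<open>N\<close>.\<close>
      define B where "B = \<bar>N\<bar> + \<bar>i\<bar> + 2"
      have B: "B > 0" "B = \<bar>N\<bar> + \<bar>i\<bar> + 2" by (simp_all add: B_def)
      obtain C where C: "2 * int m * B = C" by blast
      have scale: "B \<le> C" unfolding C[symmetric] using m B(1) by simp
      have "-1 - (i + 2 * int m * (- B)) > N"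
        using scale B unfolding mult_minus_right C by linarith
      then have "- B \<in> A"
        unfolding A_def using sym[of "i + 2 * int m * (- B)"] N by force
      have bound: "n \<le> B" if "n \<in> A" for n
      proof (rule ccontr)
        assume "\<not> n \<le> B"
        then have "C \<le> 2 * int m * n" unfolding C[symmetric] using m by simp
        moreover have "i + 2 * int m * n \<le> N" using that N by (simp add: A_def)
        ultimately show False using scale B by linarith
      qed
      have fin: "finite (A \<inter> {-B..})" by (rule finite_subset[of _ "{-B..B}"]) (use bound in auto)
      define h where "h = Max (A \<inter> {-B..})"
      have "h \<in> A" using Max_in[OF fin] \<open>- B \<in> A\<close> unfolding h_def by blast
      moreover have "n \<le> h" if "n \<in> A" for n
      proof (cases "n \<ge> -B")
        case True
        then show ?thesis using Max_ge[OF fin] that by (simp add: h_def)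
      next
        case False
        moreover have "- B \<le> h" using Max_ge[OF fin] \<open>- B \<in> A\<close> by (simp add: h_def)
        ultimately show ?thesis by simp
      qed
      ultimately have "n \<in> A \<longleftrightarrow> n \<le> h" for n
        using down[of i h n] unfolding A_def by blast
      then show ?thesis unfolding A_def by blast
    qed
    then obtain f where f: "\<And>i n. i + 2 * int m * n \<in> S \<longleftrightarrow> n \<le> f i" by metis
    \<comment> \<open>An integer is determined by its lower bounds, so identities for
      \<open>f\<close> can be read off from membership in \<open>S\<close>.\<close>
    have eqI: "x = y" if "\<And>n::int. n \<le> x \<longleftrightarrow> n \<le> y" for x y
      using that by (metis order_antisym order_refl)
    have "f (i + 2 * int m) = f i - 1" for i
    proof (rule eqI)
      fix n
      have "n \<le> f (i + 2 * int m) \<longleftrightarrow> i + 2 * int m * (n + 1) \<in> S"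
        by (simp add: f[symmetric] algebra_simps)
      then show "n \<le> f (i + 2 * int m) \<longleftrightarrow> n \<le> f i - 1" by (auto simp: f)
    qed
    moreover have "f (-1 - i) = -1 - f i" for i
    proof (rule eqI)
      fix n
      have "n \<le> f (-1 - i) \<longleftrightarrow> -1 - (i + 2 * int m * (- n)) \<in> S"
        by (simp add: f[symmetric] algebra_simps)
      also have "\<dots> \<longleftrightarrow> \<not> - n \<le> f i" by (simp add: sym f del: mult_minus_right)
      finally show "n \<le> f (-1 - i) \<longleftrightarrow> n \<le> -1 - f i" by auto
    qed
    moreover have "f q \<le> f p + 1" if "p < q" "q \<le> p + int K" for p q
    proof -
      \<comment> \<open>The top of the column of \<open>q\<close>, lowered by
        \<open>2 * m + (q - p)\<close>, lands in the column of \<open>p\<close> one level further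
        down.\<close>
      have "q + 2 * int m * f q - int (2 * m + nat (q - p)) \<in> S"
        by (rule closed) (use that f in auto)
      then have "p + 2 * int m * (f q - 1) \<in> S" using that by (simp add: algebra_simps)
      then show ?thesis by (simp add: f)
    qed
    ultimately have "f \<in> profiles m K" by (simp add: profiles_def)
    moreover have "S = {x. 0 \<le> f x}" using f[of _ 0] by auto
    ultimately show "S \<in> (\<lambda>f. {x. 0 \<le> f x}) ` profiles m K" by blast
  qed
qed

text \<open>The last two conditions on the right are what the window condition says across the two
  centres of symmetry \<open>-1/2\<close> and \<open>m - 1/2\<close> of a profile.\<close>

lemma window_condition_iff:
  fixes f :: "int \<Rightarrow> int"
  assumes per: "\<And>i. f (i + 2 * int m) = f i - 1" and sym: "\<And>i. f (-1 - i) = -1 - f i"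
    and m: "m > 0" and K: "K > 0"
  shows "(\<forall>p q. p < q \<longrightarrow> q \<le> p + int K \<longrightarrow> f q \<le> f p + 1) \<longleftrightarrow>
    (\<forall>p q. 0 \<le> p \<longrightarrow> p < q \<longrightarrow> q < int m \<longrightarrow> q \<le> p + int K \<longrightarrow> f q \<le> f p + 1) \<and>
    (\<forall>q. 0 \<le> q \<longrightarrow> q < int m \<longrightarrow> q < int K \<longrightarrow> f q \<le> 0) \<and>
    (\<forall>p q. 0 \<le> p \<longrightarrow> p < int m \<longrightarrow> 0 \<le> q \<longrightarrow> q < int m \<longrightarrow>
       2 * int m - 2 - p - q < int K \<longrightarrow> -3 \<le> f p + f q)"
    (is "?all \<longleftrightarrow> ?inner \<and> ?start \<and> ?end")
proof (intro iffI conjI)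
  have sym': "f (2 * int m - 1 - i) = -2 - f i" for i
    using per[of "-1 - i"] sym[of i] by (simp add: algebra_simps)
  {
    assume all: ?all
    show ?inner using all by blast
    show ?start
    proof (intro allI impI)
      fix q assume q: "0 \<le> q" "q < int m" "q < int K"
      \<comment> \<open>Comparison with positions \<open>-1\<close> and \<open>0\<close> gives
        \<open>f q \<le> - f 0\<close> and \<open>f q \<le> f 0 + 1\<close>, so
        \<open>2 * f q \<le> 1\<close>; integrality does the rest.\<close>
      have "f q \<le> f (-1) + 1" using all q by simp
      moreover have "f (-1) = -1 - f 0" using sym[of 0] by simp
      moreover have "f q \<le> f 0 + 1" using all q by (cases "q = 0") auto
      ultimately show "f q \<le> 0" by linarith
    qed
    show ?end
    proof (intro allI impI)
      fix p q assume *: "0 \<le> p" "p < int m" "0 \<le> q" "q < int m" "2 * int m - 2 - p - q < int K"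
      then have "f (2 * int m - 1 - q) \<le> f p + 1" using all by simp
      then show "-3 \<le> f p + f q" using sym' by simp
    qed
  }
  assume "?inner \<and> ?start \<and> ?end"
  then have inner: "\<And>p q. \<lbrakk>0 \<le> p; p < q; q < int m; q \<le> p + int K\<rbrakk> \<Longrightarrow> f q \<le> f p + 1"
    and start: "\<And>q. \<lbrakk>0 \<le> q; q < int m; q < int K\<rbrakk> \<Longrightarrow> f q \<le> 0"
    and "end": "\<And>p q. \<lbrakk>0 \<le> p; p < int m; 0 \<le> q; q < int m; 2 * int m - 2 - p - q < int K\<rbrakk>
      \<Longrightarrow> -3 \<le> f p + f q"
    by blast+
  \<comment> \<open>The counterpart at the right centre: the rise from \<open>p\<close> to
    \<open>m - 1\<close> and the end condition for this pair give
    \<open>-4 \<le> 2 * f p\<close>.\<close>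
  have lower: "-2 \<le> f p" if "0 \<le> p" "p < int m" "int m \<le> p + int K" for p
  proof (cases "p = int m - 1")
    case True
    then show ?thesis using "end"[of p p] that K by simp
  next
    case False
    then have "f (int m - 1) \<le> f p + 1" using inner[of p "int m - 1"] that by simp
    moreover have "-3 \<le> f (int m - 1) + f p" using "end"[of "int m - 1" p] that by simp
    ultimately show ?thesis by linarith
  qed
  \<comment> \<open>This is the window condition from \<open>j\<close> to the translate
    \<open>i + 2 * m\<close>, across two consecutive centres of symmetry.\<close>
  have wrap: "f i \<le> f j + 2" if "0 \<le> i" "i < j" "j < int m" "2 * int m + i - j \<le> int K" for i j
    using start[of i] lower[of j] that by simp
  have near: "f q \<le> f p + 1"
    if p: "0 \<le> p" "p < 2 * int m" and q: "p < q" "q < p + 2 * int m" "q \<le> p + int K" for p q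
  proof -
    \<comment> \<open>Both positions are folded into the first \<open>m\<close> places:
      \<open>p'\<close> and \<open>q1\<close> reflect in m - 1/2, \<open>q2\<close> shifts by a
      period, \<open>q3\<close> reflects in 2 m - 1/2.\<close>
    define p' where "p' = 2 * int m - 1 - p"
    have fp: "f p = -2 - f p'" using sym'[of p'] by (simp add: p'_def)
    define q1 where "q1 = 2 * int m - 1 - q"
    have fq1: "f q = -2 - f q1" using sym'[of q1] by (simp add: q1_def)
    define q2 where "q2 = q - 2 * int m"
    have fq2: "f q = f q2 - 1" using per[of q2] by (simp add: q2_def)
    define q3 where "q3 = 4 * int m - 1 - q"
    have fq3: "f q = -3 - f q3"
      using sym'[of q3] per[of "2 * int m - 1 - q3"] by (simp add: q3_def)
    show ?thesis
    proof (cases "p < int m")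
      case True
      consider "q < int m" | "int m \<le> q" "q < 2 * int m" | "2 * int m \<le> q" by linarith
      then show ?thesis
      proof cases
        case 1
        then show ?thesis using inner p q by simp
      next
        case 2
        then show ?thesis
          using "end"[of p q1] p q True fq1 by (simp add: q1_def)
      next
        case 3
        then show ?thesis using wrap[of q2 p] p q True fq2 by (simp add: q2_def)
      qed
    next
      case False
      consider "q < 2 * int m" | "2 * int m \<le> q" "q < 3 * int m" | "3 * int m \<le> q" by linarith
      then show ?thesis
      proof cases
        case 1
        then show ?thesis
          using inner[of q1 p'] p q False fp fq1 by (simp add: p'_def q1_def)
      next
        case 2
        have "f q2 \<le> 0" "f p' \<le> 0"
          using 2 p q False by (auto simp: p'_def q2_def intro!: start)
        then show ?thesis using fp fq2 by simp
      next
        case 3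
        then show ?thesis
          using wrap[of p' q3] p q False fp fq3 by (simp add: p'_def q3_def)
      qed
    qed
  qed
  show ?all
  proof (intro allI impI)
    fix p q assume pq: "p < q" "q \<le> p + int K"
    define M where "M = 2 * int m"
    have M: "M > 0" using m by (simp add: M_def)
    have per': "f (i + M * n) = f i - n" for i n
      unfolding M_def by (rule quasi_periodic) (rule per)
    \<comment> \<open>Moving \<open>p\<close> to its residue changes both sides equally; removing
      whole periods from \<open>q - p\<close> can only raise the left side.\<close>
    define u where "u = p mod M"
    define w where "w = u + (q - p) mod M"
    have "p = u + M * (p div M)" by (simp add: u_def)
    then have fp: "f p = f u - p div M" using per' by metis
    have "q = w + M * (p div M + (q - p) div M)"
      unfolding w_def u_def distrib_left using mult_div_mod_eq[of M p] mult_div_mod_eq[of M "q - p"]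
      by linarith
    then have fq: "f q = f w - (p div M + (q - p) div M)" using per' by metis
    have nonneg: "(q - p) div M \<ge> 0" using pq M by (simp add: pos_imp_zdiv_nonneg_iff)
    show "f q \<le> f p + 1"
    proof (cases "(q - p) mod M = 0")
      case True
      then show ?thesis using fp fq nonneg by (simp add: w_def)
    next
      case False
      have "(q - p) mod M \<le> q - p" using pq M by (intro zmod_le_nonneg_dividend) simp
      moreover have "0 < (q - p) mod M"
        using False M by (metis order.not_eq_order_implies_strict pos_mod_sign)
      moreover have "(q - p) mod M < M" "0 \<le> u" "u < M"
        using M by (simp_all add: u_def)
      ultimately have "f w \<le> f u + 1"
        using pq by (intro near) (simp_all add: w_def M_def)
      then show ?thesis using fp fq nonneg by simp
    qed
  qed
qed

subsection \<open>Reading off a profile from left to right\<close>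

text \<open>The state \<open>v, j\<close> consists of the minimum \<open>v\<close> of the last \<open>2 k + 1\<close> values and the number
  \<open>j\<close> of values, all of them \<open>v + 1\<close>, read since it was last attained. Reading starts with \<open>-1\<close> as
  a virtual value at position \<open>-1\<close>, which accounts for the condition at the left centre of symmetry;
  the acceptance condition accounts for the right one.\<close>

fun admissible :: "nat \<Rightarrow> int \<Rightarrow> nat \<Rightarrow> int list \<Rightarrow> bool" where
  "admissible k v j [] \<longleftrightarrow> -1 \<le> v \<or> v = -2 \<and> k < j"
| "admissible k v j (x # xs) \<longleftrightarrow>
     (if x \<le> v then admissible k x 0 xs
      else x = v + 1 \<and> (if j < 2 * k then admissible k v (Suc j) xs else admissible k (v + 1) 0 xs))"

text \<open>The history \<open>h\<close> lists the values read so far, the most recent one first.\<close>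

definition window_state :: "nat \<Rightarrow> int \<Rightarrow> nat \<Rightarrow> int list \<Rightarrow> bool" where
  "window_state K v j h \<longleftrightarrow> j < K \<and>
     (\<exists>r. h = replicate j (v + 1) @ v # r \<and> (\<forall>y \<in> set (take (K - 1) r). v \<le> y))"

fun slow_rise :: "nat \<Rightarrow> int list \<Rightarrow> bool" where
  "slow_rise K [] \<longleftrightarrow> True"
| "slow_rise K (x # h) \<longleftrightarrow> slow_rise K h \<and> (\<forall>y \<in> set (take K h). x \<le> y + 1)"

text \<open>Entries \<open>i\<close> and \<open>j\<close> of the history sit at
  \<open>m - 1 - i\<close> and \<open>m - 1 - j\<close>; reflecting one of them in m - 1/2 puts them
  at distance \<open>i + j + 1\<close>, which is at most \<open>K\<close>. The reflected value is
  \<open>-2 - h ! j\<close>, whence the bound \<open>-3\<close>.\<close>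

definition end_bounded :: "nat \<Rightarrow> int list \<Rightarrow> bool" where
  "end_bounded K h \<longleftrightarrow> (\<forall>i < length h. \<forall>j < length h. i + j < K \<longrightarrow> -3 \<le> h ! i + h ! j)"

lemma window_stateE:
  assumes "window_state K v j h"
  obtains r where "j < K" "h = replicate j (v + 1) @ v # r" "\<And>y. y \<in> set (take (K - 1) r) \<Longrightarrow> v \<le> y"
    "take K h = replicate j (v + 1) @ v # take (K - 1 - j) r"
    "\<And>y. y \<in> set (take (K - 1 - j) r) \<Longrightarrow> v \<le> y"
proof -
  obtain r where r: "j < K" "h = replicate j (v + 1) @ v # r" "\<And>y. y \<in> set (take (K - 1) r) \<Longrightarrow> v \<le> y"
    using assms by (auto simp: window_state_def)
  moreover obtain d where "K = Suc (j + d)" using r(1) less_iff_Suc_add by blast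
  then have "take K h = replicate j (v + 1) @ v # take (K - 1 - j) r"
    using r(2) by simp
  moreover have "set (take (K - 1 - j) r) \<subseteq> set (take (K - 1) r)"
    by (rule set_take_subset_set_take) simp
  ultimately show ?thesis using that by blast
qed

lemma window_state_next_iff:
  assumes "window_state K v j h"
  shows "(\<forall>y \<in> set (take K h). x \<le> y + 1) \<longleftrightarrow> x \<le> v + 1"
  using assms by (elim window_stateE) fastforce

lemma window_state_drop:
  assumes "window_state K v j h" "x \<le> v"
  shows "window_state K x 0 (x # h)"
proof -
  have "set (take (K - 1) h) \<subseteq> set (take K h)" by (rule set_take_subset_set_take) simp
  moreover have "x \<le> y" if "y \<in> set (take K h)" for y
  proof -
    have "v \<le> y"
      using assms(1) by (rule window_stateE) (use that in auto)
    then show ?thesis using assms(2) by simp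
  qed
  ultimately show ?thesis
    using assms(1) by (auto simp: window_state_def)
qed

lemma window_state_stay:
  assumes "window_state K v j h" "Suc j < K"
  shows "window_state K v (Suc j) ((v + 1) # h)"
  using assms by (auto simp: window_state_def)

text \<open>The new value pushes the last \<open>v\<close> out of the window, which then consists of
  \<open>K\<close> copies of \<open>v + 1\<close>.\<close>

lemma window_state_rise:
  assumes "window_state K v j h" "K = Suc j"
  shows "window_state K (v + 1) 0 ((v + 1) # h)"
  using assms by (auto simp: window_state_def)

text \<open>Within the window, entries before index \<open>j\<close> are \<open>v + 1\<close>, entry
  \<open>j\<close> is \<open>v\<close>, and the others are at least \<open>v\<close>. For
  \<open>v = -2\<close> only two entries \<open>-2\<close> can violate the bound: indices
  \<open>j, j\<close> do if \<open>j \<le> k\<close>, while for \<open>k < j\<close> one of two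
  indices with sum at most \<open>2 * k\<close> lies before \<open>j\<close>. For
  \<open>v < -2\<close> the indices \<open>0, j\<close> violate it.\<close>

lemma window_state_end_bounded:
  assumes "window_state (2 * k + 1) v j h"
  shows "end_bounded (2 * k + 1) h \<longleftrightarrow> -1 \<le> v \<or> v = -2 \<and> k < j"
proof -
  let ?K = "2 * k + 1"
  obtain r where r: "j < ?K" "h = replicate j (v + 1) @ v # r"
    "take ?K h = replicate j (v + 1) @ v # take (?K - 1 - j) r"
    "\<And>y. y \<in> set (take (?K - 1 - j) r) \<Longrightarrow> v \<le> y"
    using window_stateE[OF assms] by metis
  have hj: "h ! j = v" "j < length h" using r(2) by (auto simp: nth_append)
  have hlt: "h ! i = v + 1" if "i < j" for i using r(2) that by (auto simp: nth_append)
  have hge: "v \<le> h ! i" if "i < ?K" "i < length h" for i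
  proof -
    have "h ! i \<in> set (take ?K h)" using that by (metis length_take min_less_iff_conj nth_mem nth_take)
    then show ?thesis using r(3,4) by auto
  qed
  show ?thesis
  proof
    assume bounded: "end_bounded ?K h"
    have "-2 \<le> v"
    proof (cases "j = 0")
      case True
      then show ?thesis
        using bounded[unfolded end_bounded_def, rule_format, of 0 0] hj by auto
    next
      case False
      then have "-3 \<le> h ! 0 + h ! j"
        using bounded hj r(1) unfolding end_bounded_def by (metis add_0 gr0I less_trans)
      then show ?thesis using hlt[of 0] hj False by simp
    qed
    moreover have "k < j" if "v = -2"
    proof (rule ccontr)
      assume "\<not> k < j"
      then show False
        using bounded[unfolded end_bounded_def, rule_format, of j j] hj that by simp
    qed
    ultimately show "-1 \<le> v \<or> v = -2 \<and> k < j" by linarith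
  next
    assume v: "-1 \<le> v \<or> v = -2 \<and> k < j"
    show "end_bounded ?K h"
      unfolding end_bounded_def
    proof (intro allI impI)
      fix a b assume ab: "a < length h" "b < length h" "a + b < ?K"
      have ge: "v \<le> h ! a" "v \<le> h ! b" using hge ab by auto
      show "-3 \<le> h ! a + h ! b"
      proof (cases "-1 \<le> v")
        case True
        then show ?thesis using ge by simp
      next
        case False
        then have "a < j \<or> b < j" using v ab by auto
        then show ?thesis using hlt ge v False by fastforce
      qed
    qed
  qed
qed

text \<open>Generalised over the history, so that induction on the unread values can push each one
  onto it. Too large a rise is never repaired, as \<open>slow_rise\<close> passes to
  suffixes.\<close>

lemma admissible_iff:
  assumes "window_state (2 * k + 1) v j h" "slow_rise (2 * k + 1) h"
  shows "slow_rise (2 * k + 1) (rev xs @ h) \<and> end_bounded (2 * k + 1) (rev xs @ h) \<longleftrightarrow>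
    admissible k v j xs"
  using assms
proof (induction xs arbitrary: v j h)
  case Nil
  then show ?case using window_state_end_bounded[OF Nil.prems(1)] by simp
next
  case (Cons x xs)
  have j: "j < 2 * k + 1" using Cons.prems(1) by (simp add: window_state_def)
  have rise: "slow_rise (2 * k + 1) (x # h) \<longleftrightarrow> x \<le> v + 1"
    using window_state_next_iff[OF Cons.prems(1)] Cons.prems(2) by simp
  have suffix: "slow_rise (2 * k + 1) (ys @ zs) \<Longrightarrow> slow_rise (2 * k + 1) zs" for ys zs
    by (induction ys) auto
  consider "x > v + 1" | "x \<le> v" | "x = v + 1" "j < 2 * k" | "x = v + 1" "j = 2 * k"
    using j by linarith
  then show ?case
  proof cases
    case 1
    then show ?thesis using rise suffix[of "rev xs" "x # h"] by auto
  next
    case 2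
    then show ?thesis
      using Cons.IH[OF window_state_drop[OF Cons.prems(1) 2]] rise by simp
  next
    case 3
    then show ?thesis
      using Cons.IH[OF window_state_stay[OF Cons.prems(1)]] rise by simp
  next
    case 4
    then show ?thesis
      using Cons.IH[OF window_state_rise[OF Cons.prems(1)]] rise by simp
  qed
qed

lemma slow_rise_iff_nth:
  "slow_rise K h \<longleftrightarrow> (\<forall>i j. i < j \<longrightarrow> j < length h \<longrightarrow> j \<le> i + K \<longrightarrow> h ! i \<le> h ! j + 1)"
proof (induction h)
  case (Cons x h)
  have "(\<forall>i j. i < j \<longrightarrow> j < length (x # h) \<longrightarrow> j \<le> i + K \<longrightarrow> (x # h) ! i \<le> (x # h) ! j + 1) \<longleftrightarrow>
    (\<forall>i j. i < j \<longrightarrow> j < length h \<longrightarrow> j \<le> i + K \<longrightarrow> h ! i \<le> h ! j + 1) \<and>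
    (\<forall>j. j < length h \<longrightarrow> j < K \<longrightarrow> x \<le> h ! j + 1)" (is "?L \<longleftrightarrow> ?R")
  proof
    assume L: ?L
    have "h ! i \<le> h ! j + 1" if "i < j" "j < length h" "j \<le> i + K" for i j
      using L[rule_format, of "Suc i" "Suc j"] that by simp
    moreover have "x \<le> h ! j + 1" if "j < length h" "j < K" for j
      using L[rule_format, of 0 "Suc j"] that by simp
    ultimately show ?R by blast
  next
    assume ?R
    then show ?L by (auto simp: nth_Cons split: nat.split)
  qed
  moreover have "(\<forall>y \<in> set (take K h). x \<le> y + 1) \<longleftrightarrow>
    (\<forall>j. j < length h \<longrightarrow> j < K \<longrightarrow> x \<le> h ! j + 1)"
    by (auto simp: all_set_conv_all_nth)
  ultimately show ?case using Cons.IH by simp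
qed simp

lemma admissible_profile_iff:
  fixes f :: "int \<Rightarrow> int"
  assumes per: "\<And>i. f (i + 2 * int m) = f i - 1" and sym: "\<And>i. f (-1 - i) = -1 - f i"
    and m: "m > 0"
  shows "admissible k (-1) 0 (map (\<lambda>i. f (int i)) [0..<m]) \<longleftrightarrow>
    (\<forall>p q. p < q \<longrightarrow> q \<le> p + int (2 * k + 1) \<longrightarrow> f q \<le> f p + 1)"
proof -
  define K where "K = 2 * k + 1"
  define a where "a = map (\<lambda>i. f (int i)) [0..<m]"
  \<comment> \<open>Index \<open>i < m\<close> of the history is position \<open>m - 1 - i\<close>;
    index \<open>m\<close> is the virtual value at position \<open>-1\<close>, within distance
    \<open>K\<close> of \<open>q\<close> exactly if \<open>q < K\<close>.\<close>
  define h where "h = rev a @ [-1]"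
  have len: "length h = Suc m" by (simp add: h_def a_def)
  have nth: "h ! i = f (int m - 1 - int i)" if "i < m" for i
    using that by (simp add: h_def a_def nth_append rev_nth of_nat_diff diff_diff_eq)
  have last: "h ! m = -1" by (simp add: h_def a_def nth_append)
  have nth': "h ! nat (int m - 1 - p) = f p" if "0 \<le> p" "p < int m" for p
    using that nth[of "nat (int m - 1 - p)"] by simp
  have "admissible k (-1) 0 a \<longleftrightarrow> slow_rise K h \<and> end_bounded K h"
    unfolding h_def K_def
    by (rule admissible_iff[symmetric]) (auto simp: window_state_def)
  also have "\<dots> \<longleftrightarrow>
    (\<forall>p q. 0 \<le> p \<longrightarrow> p < q \<longrightarrow> q < int m \<longrightarrow> q \<le> p + int K \<longrightarrow> f q \<le> f p + 1) \<and>
    (\<forall>q. 0 \<le> q \<longrightarrow> q < int m \<longrightarrow> q < int K \<longrightarrow> f q \<le> 0) \<and>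
    (\<forall>p q. 0 \<le> p \<longrightarrow> p < int m \<longrightarrow> 0 \<le> q \<longrightarrow> q < int m \<longrightarrow>
       2 * int m - 2 - p - q < int K \<longrightarrow> -3 \<le> f p + f q)"
    (is "?slow \<and> ?bounded \<longleftrightarrow> ?inner \<and> ?start \<and> ?end")
  proof (intro iffI conjI)
    assume *: "?slow \<and> ?bounded"
    then have slow: "\<And>i j. i < j \<Longrightarrow> j < length h \<Longrightarrow> j \<le> i + K \<Longrightarrow> h ! i \<le> h ! j + 1"
      unfolding slow_rise_iff_nth by blast
    show ?inner
    proof (intro allI impI)
      fix p q assume pq: "0 \<le> p" "p < q" "q < int m" "q \<le> p + int K"
      have "h ! nat (int m - 1 - q) \<le> h ! nat (int m - 1 - p) + 1"
        using pq by (intro slow) (auto simp: len)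
      then show "f q \<le> f p + 1" using pq by (simp add: nth')
    qed
    show ?start
    proof (intro allI impI)
      fix q assume q: "0 \<le> q" "q < int m" "q < int K"
      have "h ! nat (int m - 1 - q) \<le> h ! m + 1"
        using q by (intro slow) (auto simp: len)
      then show "f q \<le> 0" using q by (simp add: nth' last)
    qed
    show ?end
    proof (intro allI impI)
      fix p q assume pq: "0 \<le> p" "p < int m" "0 \<le> q" "q < int m" "2 * int m - 2 - p - q < int K"
      have "nat (int m - 1 - p) < length h" "nat (int m - 1 - q) < length h"
        "nat (int m - 1 - p) + nat (int m - 1 - q) < K"
        using pq by (auto simp: len)
      then have "-3 \<le> h ! nat (int m - 1 - p) + h ! nat (int m - 1 - q)"
        using * unfolding end_bounded_def by blast
      then show "-3 \<le> f p + f q" using pq by (simp add: nth')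
    qed
  next
    assume *: "?inner \<and> ?start \<and> ?end"
    then have inner: "\<And>p q. \<lbrakk>0 \<le> p; p < q; q < int m; q \<le> p + int K\<rbrakk> \<Longrightarrow> f q \<le> f p + 1"
      and start: "\<And>q. \<lbrakk>0 \<le> q; q < int m; q < int K\<rbrakk> \<Longrightarrow> f q \<le> 0"
      and "end": "\<And>p q. \<lbrakk>0 \<le> p; p < int m; 0 \<le> q; q < int m; 2 * int m - 2 - p - q < int K\<rbrakk>
        \<Longrightarrow> -3 \<le> f p + f q"
      by blast+
    show ?slow
      unfolding slow_rise_iff_nth
    proof (intro allI impI)
      fix i j assume ij: "i < j" "j < length h" "j \<le> i + K"
      show "h ! i \<le> h ! j + 1"
      proof (cases "j = m")
        case True
        then show ?thesis
          using start[of "int m - 1 - int i"] ij by (simp add: nth last)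
      next
        case False
        then show ?thesis
          using inner[of "int m - 1 - int j" "int m - 1 - int i"] ij by (simp add: nth len)
      qed
    qed
    \<comment> \<open>\<open>end_bounded\<close> also pairs values with the virtual
      \<open>-1\<close>; there the bound reads \<open>-2 \<le> f\<close>, and it follows from the
      inner and end conditions.\<close>
    have low: "-2 \<le> f (int m - 1 - int i)" if "i < m" "m + i < K" for i
    proof -
      have "f (int m - 1) \<le> f (int m - 1 - int i) + 1"
        using inner[of "int m - 1 - int i" "int m - 1"] that by (cases "i = 0") auto
      moreover have "-3 \<le> f (int m - 1) + f (int m - 1 - int i)"
        using "end"[of "int m - 1" "int m - 1 - int i"] that by simp
      ultimately show ?thesis by linarith
    qed
    show ?bounded
      unfolding end_bounded_def
    proof (intro allI impI)
      fix i j assume ij: "i < length h" "j < length h" "i + j < K"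
      consider "i < m" "j < m" | "i < m" "j = m" | "i = m" "j < m" | "i = m" "j = m"
        using ij by (auto simp: len less_Suc_eq)
      then show "-3 \<le> h ! i + h ! j"
      proof cases
        case 1
        then show ?thesis
          using "end"[of "int m - 1 - int i" "int m - 1 - int j"] ij by (simp add: nth)
      qed (use low[of i] low[of j] ij in \<open>simp_all add: nth last\<close>)
    qed
  qed
  also have "\<dots> \<longleftrightarrow> (\<forall>p q. p < q \<longrightarrow> q \<le> p + int K \<longrightarrow> f q \<le> f p + 1)"
    by (rule window_condition_iff[symmetric]) (use per sym m in \<open>simp_all add: K_def\<close>)
  finally show ?thesis by (simp add: a_def K_def)
qed

lemma profile_extension:
  fixes a :: "nat \<Rightarrow> int"
  assumes m: "m > 0"
  obtains f :: "int \<Rightarrow> int" where "\<And>i. f (i + 2 * int m) = f i - 1"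
    "\<And>i. f (-1 - i) = -1 - f i" "\<And>i. i < m \<Longrightarrow> f (int i) = a i"
proof
  define M where "M = 2 * int m"
  have M: "M > 0" using m by (simp add: M_def)
  \<comment> \<open>The second half of a period is filled by reflection in m - 1/2.\<close>
  define b where "b r = (if r < int m then a (nat r) else -2 - a (nat (M - 1 - r)))" for r
  define f where "f x = b (x mod M) - x div M" for x
  show "f (i + 2 * int m) = f i - 1" for i
    using M unfolding f_def M_def[symmetric] by simp
  show "f (int i) = a i" if "i < m" for i
    using that by (simp add: f_def b_def M_def)
  show "f (-1 - i) = -1 - f i" for i
  proof -
    define r q where "r = i mod M" and "q = i div M"
    have r: "0 \<le> r" "r < M" using M by (simp_all add: r_def)
    have "i = M * q + r" by (simp add: r_def q_def)
    then have eq: "-1 - i = M * (-1 - q) + (M - 1 - r)" by (simp add: algebra_simps)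
    have "(-1 - i) div M = -1 - q" "(-1 - i) mod M = M - 1 - r"
      using int_div_pos_eq[OF eq] int_mod_pos_eq[OF eq] r by auto
    then have "f (-1 - i) = b (M - 1 - r) + 1 + q" by (simp add: f_def)
    also have "b (M - 1 - r) = -2 - b r"
      using r by (auto simp: b_def M_def)
    finally show ?thesis by (simp add: f_def r_def q_def)
  qed
qed

text \<open>The first \<open>m\<close> values fix a profile: reflection supplies the other half of a
  period and quasi-periodicity everything else.\<close>

lemma bij_betw_profiles_admissible:
  assumes m: "m > 0"
  shows "bij_betw (\<lambda>f. map (\<lambda>i. f (int i)) [0..<m]) (profiles m (2 * k + 1))
    {xs. length xs = m \<and> admissible k (-1) 0 xs}"
  unfolding bij_betw_def
proof
  have profiles_iff: "f \<in> profiles m (2 * k + 1) \<longleftrightarrow>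
      (\<forall>i. f (i + 2 * int m) = f i - 1) \<and> (\<forall>i. f (-1 - i) = -1 - f i) \<and>
      admissible k (-1) 0 (map (\<lambda>i. f (int i)) [0..<m])" for f
    unfolding profiles_def using admissible_profile_iff[of f m k] m by auto
  show "inj_on (\<lambda>f. map (\<lambda>i. f (int i)) [0..<m]) (profiles m (2 * k + 1))"
  proof (rule inj_onI, rule ext)
    fix f g x
    assume f: "f \<in> profiles m (2 * k + 1)" and g: "g \<in> profiles m (2 * k + 1)"
      and maps: "map (\<lambda>i. f (int i)) [0..<m] = map (\<lambda>i. g (int i)) [0..<m]"
    have eq: "f i = g i" if "0 \<le> i" "i < int m" for i
      using arg_cong[OF maps, of "\<lambda>xs. xs ! nat i"] that by (simp add: nat_less_iff)
    have per: "u (i + 2 * int m * n) = u i - n" if "u \<in> profiles m (2 * k + 1)" for u i n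
      using that by (auto simp: profiles_def intro!: quasi_periodic)
    have sym: "u i = -2 - u (2 * int m - 1 - i)" if "u \<in> profiles m (2 * k + 1)" for u i
    proof -
      have "u (-1 - i) = -1 - u i" using that by (simp add: profiles_def)
      then show ?thesis using per[OF that, of "-1 - i" 1] by (simp add: algebra_simps)
    qed
    define r where "r = x mod (2 * int m)"
    have r: "0 \<le> r" "r < 2 * int m" using m by (simp_all add: r_def)
    have "f r = g r"
    proof (cases "r < int m")
      case True
      then show ?thesis using eq r by simp
    next
      case False
      then show ?thesis
        using eq[of "2 * int m - 1 - r"] sym[OF f, of r] sym[OF g, of r] r by simp
    qed
    moreover have "x = r + 2 * int m * (x div (2 * int m))" by (simp add: r_def)
    ultimately show "f x = g x" using per[OF f] per[OF g] by metis
  qed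
  show "(\<lambda>f. map (\<lambda>i. f (int i)) [0..<m]) ` profiles m (2 * k + 1) =
    {xs. length xs = m \<and> admissible k (-1) 0 xs}"
  proof (intro equalityI subsetI)
    fix xs assume "xs \<in> {xs. length xs = m \<and> admissible k (-1) 0 xs}"
    then have xs: "length xs = m" "admissible k (-1) 0 xs" by auto
    obtain f where f: "\<And>i. f (i + 2 * int m) = f i - 1" "\<And>i. f (-1 - i) = -1 - f i"
      "\<And>i. i < m \<Longrightarrow> f (int i) = xs ! i"
      using profile_extension[OF m, of "\<lambda>i. xs ! i"] by metis
    have "map (\<lambda>i. f (int i)) [0..<m] = xs"
      by (rule nth_equalityI) (use f(3) xs in auto)
    moreover from this have "f \<in> profiles m (2 * k + 1)"
      using f(1,2) xs(2) unfolding profiles_iff by blast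
    ultimately show "xs \<in> (\<lambda>f. map (\<lambda>i. f (int i)) [0..<m]) ` profiles m (2 * k + 1)"
      by blast
  qed (use profiles_iff in auto)
qed

section \<open>Counting admissible words\<close>

text \<open>Each letter raises the window minimum by at most one, and acceptance needs a minimum of
  at least \<open>-2\<close>. This leaves finitely many choices for every letter.\<close>

lemma admissible_lower_bound: "admissible k v j xs \<Longrightarrow> -2 - int (length xs) \<le> v"
proof (induction xs arbitrary: v j)
  case (Cons x xs)
  then show ?case by (fastforce split: if_splits)
qed auto

lemma finite_admissible: "finite {xs. length xs = n \<and> admissible k v j xs}"
proof (induction n arbitrary: v j)
  case 0
  show ?case by (rule finite_subset[of _ "{[]}"]) auto
next
  case (Suc n)
  have "{xs. length xs = Suc n \<and> admissible k v j xs} \<subseteq>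
      (\<Union>x \<in> {-2 - int n..v}. (#) x ` {xs. length xs = n \<and> admissible k x 0 xs}) \<union>
      (#) (v + 1) ` ({xs. length xs = n \<and> admissible k v (Suc j) xs} \<union>
        {xs. length xs = n \<and> admissible k (v + 1) 0 xs})"
  proof
    fix xs assume "xs \<in> {xs. length xs = Suc n \<and> admissible k v j xs}"
    then obtain y ys where ys: "xs = y # ys" "length ys = n" "admissible k v j (y # ys)"
      by (auto simp: length_Suc_conv)
    then show "xs \<in> (\<Union>x \<in> {-2 - int n..v}. (#) x ` {xs. length xs = n \<and> admissible k x 0 xs}) \<union>
      (#) (v + 1) ` ({xs. length xs = n \<and> admissible k v (Suc j) xs} \<union>
        {xs. length xs = n \<and> admissible k (v + 1) 0 xs})"
    proof (cases "y \<le> v")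
      case True
      with ys have "admissible k y 0 ys" by simp
      with ys True have "y \<in> {-2 - int n..v}" "ys \<in> {xs. length xs = n \<and> admissible k y 0 xs}"
        using admissible_lower_bound by auto
      then show ?thesis using ys(1) by blast
    qed (use ys in \<open>auto split: if_splits\<close>)
  qed
  then show ?case by (rule finite_subset) (simp add: Suc)
qed

definition num_admissible :: "nat \<Rightarrow> nat \<Rightarrow> int \<Rightarrow> nat \<Rightarrow> int" where
  "num_admissible k n v j = int (card {xs. length xs = n \<and> admissible k v j xs})"

text \<open>First letters below \<open>v\<close> lead to the same state from \<open>v\<close> and
  from \<open>v - 1\<close> and cancel. What remains is the letter \<open>v\<close> as a new minimum
  and the two rising letters; at \<open>j = 2 * k\<close> the rise from \<open>v - 1\<close> cancels
  the new minimum \<open>v\<close>.\<close>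

lemma num_admissible_Suc_diff:
  assumes "j \<le> 2 * k"
  shows "num_admissible k (Suc n) v j - num_admissible k (Suc n) (v - 1) j =
    (if j < 2 * k
     then num_admissible k n v 0 +
       (num_admissible k n v (Suc j) - num_admissible k n (v - 1) (Suc j))
     else num_admissible k n (v + 1) 0)"
proof -
  define H where "H v = {x # xs | x xs. x \<le> v \<and> length xs = n \<and> admissible k x 0 xs}" for v
  define S where "S v = (if j < 2 * k then {xs. length xs = n \<and> admissible k v (Suc j) xs}
     else {xs. length xs = n \<and> admissible k (v + 1) 0 xs})" for v
  have split: "{xs. length xs = Suc n \<and> admissible k v j xs} = H v \<union> (#) (v + 1) ` S v" for v
    by (auto simp: H_def S_def length_Suc_conv split: if_splits)
  have finS: "finite (S v)" for v by (simp add: S_def finite_admissible)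
  have finH: "finite (H v)" for v
    by (rule finite_subset[OF _ finite_admissible[of "Suc n" k v j]]) (use split in blast)
  have "num_admissible k (Suc n) v j = int (card (H v)) + int (card (S v))" for v
  proof -
    have "H v \<inter> (#) (v + 1) ` S v = {}" by (auto simp: H_def)
    then show ?thesis
      unfolding num_admissible_def split by (simp add: card_Un_disjoint finS finH card_image)
  qed
  moreover {
    have "H v = H (v - 1) \<union> (#) v ` {xs. length xs = n \<and> admissible k v 0 xs}"
      by (auto simp: H_def)
    moreover have "H (v - 1) \<inter> (#) v ` {xs. length xs = n \<and> admissible k v 0 xs} = {}"
      by (auto simp: H_def)
    ultimately have "int (card (H v)) = int (card (H (v - 1))) + num_admissible k n v 0"
      unfolding num_admissible_def by (simp add: card_Un_disjoint finH finite_admissible card_image)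
  }
  ultimately show ?thesis by (simp add: S_def num_admissible_def)
qed

text \<open>Extended by zero to negative lengths, the number of continuations of a window minimum \<open>v\<close>
  obeys a lattice path recurrence with two sources.\<close>

definition num_cont :: "nat \<Rightarrow> int \<Rightarrow> int \<Rightarrow> int" where
  "num_cont k n v = (if n < 0 then 0 else num_admissible k (nat n) v 0)"

lemma sum_from_1_Suc:
  fixes F :: "nat \<Rightarrow> 'a::comm_monoid_add"
  shows "(\<Sum>l = 1..Suc n. F l) = F 1 + (\<Sum>l = 1..n. F (Suc l))"
  by (induction n) (simp_all add: add.assoc)

text \<open>The one-letter difference is iterated until \<open>j\<close> reaches
  \<open>2 * k\<close>. If the word ends earlier, the counter stands at \<open>n + j\<close>, and
  the source term is the difference of the acceptance conditions for \<open>v\<close> and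
  \<open>v - 1\<close> there.\<close>

lemma num_admissible_diff:
  assumes "j \<le> 2 * k"
  shows "num_admissible k n v j - num_admissible k n (v - 1) j =
    (\<Sum>l = 1..2 * k - j. num_cont k (int n - int l) v) +
    num_cont k (int n - int (2 * k + 1 - j)) (v + 1) +
    (if n + j \<le> 2 * k \<and> (v = -1 \<and> n + j \<le> k \<or> v = -2 \<and> k < n + j) then 1 else 0)"
  using assms
proof (induction n arbitrary: j)
  case 0
  have "{xs. length xs = 0 \<and> admissible k v j xs} =
    (if -1 \<le> v \<or> v = -2 \<and> k < j then {[]} else {})" for v by auto
  then have "num_admissible k 0 v j = (if -1 \<le> v \<or> v = -2 \<and> k < j then 1 else 0)" for v
    unfolding num_admissible_def by simp
  then show ?case using 0 by (auto simp: num_cont_def)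
next
  case (Suc n)
  show ?case
  proof (cases "j < 2 * k")
    case True
    then have "2 * k - j = Suc (2 * k - Suc j)" by simp
    then have "(\<Sum>l = 1..2 * k - j. num_cont k (int (Suc n) - int l) v) =
        num_cont k (int n) v + (\<Sum>l = 1..2 * k - Suc j. num_cont k (int n - int l) v)"
      by (simp only: sum_from_1_Suc) simp
    moreover have "num_cont k (int n) v = num_admissible k n v 0" by (simp add: num_cont_def)
    moreover have "int (Suc n) - int (2 * k + 1 - j) = int n - int (2 * k + 1 - Suc j)"
      using True by simp
    ultimately show ?thesis
      using num_admissible_Suc_diff[OF Suc.prems, of n v] Suc.IH[of "Suc j"] True
      by (simp add: algebra_simps)
  next
    case False
    then show ?thesis
      using num_admissible_Suc_diff[OF Suc.prems, of n v] Suc.prems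
      by (simp add: num_cont_def)
  qed
qed

lemma num_cont_rec:
  assumes "n \<ge> 0"
  shows "num_cont k n v = num_cont k n (v - 1) +
    (\<Sum>l = 1..2 * k. num_cont k (n - int l) v) + num_cont k (n - int (2 * k + 1)) (v + 1) +
    (if v = -1 \<and> n \<le> int k \<or> v = -2 \<and> int k < n \<and> n \<le> 2 * int k then 1 else 0)"
proof -
  have "num_cont k n v = num_admissible k (nat n) v 0" for v
    using assms by (simp add: num_cont_def)
  moreover have "(nat n + 0 \<le> 2 * k \<and> (v = -1 \<and> nat n + 0 \<le> k \<or> v = -2 \<and> k < nat n + 0)) \<longleftrightarrow>
      v = -1 \<and> n \<le> int k \<or> v = -2 \<and> int k < n \<and> n \<le> 2 * int k"
    using assms by auto
  ultimately show ?thesis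
    using num_admissible_diff[of 0 k "nat n" v] assms by simp
qed

lemma num_cont_eq_0:
  assumes "v < -2 - n"
  shows "num_cont k n v = 0"
proof (cases "n < 0")
  case False
  then have empty: "{xs. length xs = nat n \<and> admissible k v 0 xs} = {}"
    using assms by (auto dest: admissible_lower_bound)
  show ?thesis unfolding num_cont_def num_admissible_def empty by simp
qed (simp add: num_cont_def)

subsection \<open>Symmetric paths\<close>

text \<open>An arbitrary base height is allowed because removing the first and last step of a
  symmetric path changes it.\<close>

definition sym_paths :: "nat \<Rightarrow> int \<Rightarrow> int \<Rightarrow> (rat \<times> int) list set" where
  "sym_paths K w h = {P. P \<noteq> [] \<and> hd P = (0, h) \<and> last P = (of_int w, h) \<and>
     successively (\<lambda>p q. q - p \<in> dyck_steps K) P \<and> (\<forall>p \<in> set P. snd p \<ge> 0) \<and>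
     rev (map (\<lambda>(x, y). (of_int w - x, y)) P) = P}"

lemma symmetric_dyck_paths_eq: "symmetric_dyck_paths s K = sym_paths K (int s) 0"
  by (auto simp: symmetric_dyck_paths_def dyck_path_def reflect_path_def sym_paths_def)

text \<open>Steps of a half path, with twice their width, which is the total width that the step and
  its mirror image take up.\<close>

definition double_steps :: "nat \<Rightarrow> (int \<times> int) set" where
  "double_steps K = {(int K, 1), (int K, -1)} \<union> (\<lambda>l. (2 * int l, 0)) ` {1..<K}"

lemma dyck_steps_eq: "dyck_steps K = (\<lambda>(c, d). (of_int c / 2, d)) ` double_steps K"
  unfolding dyck_steps_def double_steps_def image_Un image_insert image_empty image_image by auto

lemma dyck_steps_flip: "(x, d) \<in> dyck_steps K \<Longrightarrow> (x, - d) \<in> dyck_steps K"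
  by (auto simp: dyck_steps_def)

definition translate :: "rat \<Rightarrow> rat \<times> int \<Rightarrow> rat \<times> int" where
  "translate a p = (fst p + a, snd p)"

text \<open>Adds a first step \<open>(c / 2, d)\<close> and its mirror image. The rise
  \<open>d\<close> does not appear, as \<open>Q\<close> already lies at its final height.\<close>

definition surround :: "int \<Rightarrow> int \<Rightarrow> int \<Rightarrow> (rat \<times> int) list \<Rightarrow> (rat \<times> int) list" where
  "surround w h c Q = (0, h) # map (translate (of_int c / 2)) Q @ [(of_int w, h)]"

lemma successively_translate:
  "successively (\<lambda>p q. q - p \<in> D) (map (translate a) P) \<longleftrightarrow> successively (\<lambda>p q. q - p \<in> D) P"
  by (simp add: successively_map translate_def minus_prod_def)

lemma surround_in_sym_paths:
  assumes Q: "Q \<in> sym_paths K (w - c) (h + d)" and cd: "(c, d) \<in> double_steps K" and h: "h \<ge> 0"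
  shows "surround w h c Q \<in> sym_paths K w h"
proof -
  let ?S = "map (translate (of_int c / 2)) Q"
  have Q': "Q \<noteq> []" "hd Q = (0, h + d)" "last Q = (of_int (w - c), h + d)"
    "successively (\<lambda>p q. q - p \<in> dyck_steps K) Q" "\<forall>p \<in> set Q. snd p \<ge> 0"
    "rev (map (\<lambda>(x, y). (of_int (w - c) - x, y)) Q) = Q"
    using Q by (auto simp: sym_paths_def)
  have step: "(of_int c / 2, d) \<in> dyck_steps K" using cd by (auto simp: dyck_steps_eq)
  have "hd ?S - (0, h) \<in> dyck_steps K"
    using Q'(1,2) step by (simp add: hd_map translate_def minus_prod_def)
  moreover have "(of_int w, h) - last ?S = (of_int c / 2, - d)"
    using Q'(1,3) by (simp add: last_map translate_def minus_prod_def field_simps)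
  then have "(of_int w, h) - last ?S \<in> dyck_steps K" using dyck_steps_flip[OF step] by simp
  ultimately have "successively (\<lambda>p q. q - p \<in> dyck_steps K) (surround w h c Q)"
    using Q'(1,4) unfolding surround_def
    by (simp add: successively_Cons successively_append_iff successively_translate)
  moreover have "rev (map (\<lambda>(x, y). (of_int w - x, y)) (surround w h c Q)) = surround w h c Q"
  proof -
    have "rev (map (\<lambda>(x, y). (of_int w - x, y)) ?S) =
        map (translate (of_int c / 2)) (rev (map (\<lambda>(x, y). (of_int (w - c) - x, y)) Q))"
      by (auto simp: rev_map translate_def field_simps)
    then show ?thesis unfolding surround_def using Q'(6) by simp
  qed
  ultimately show ?thesis
    using Q'(1,5) h by (auto simp: sym_paths_def surround_def translate_def)
qed

lemma sym_paths_surround: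
  assumes P: "p # R @ [q] \<in> sym_paths K w h" and R: "R \<noteq> []"
  obtains c d Q where "(c, d) \<in> double_steps K" "Q \<in> sym_paths K (w - c) (h + d)"
    "p # R @ [q] = surround w h c Q"
proof -
  have P': "p = (0, h)" "q = (of_int w, h)"
    "successively (\<lambda>p q. q - p \<in> dyck_steps K) (p # R @ [q])" "\<forall>p \<in> set R. snd p \<ge> 0"
    "rev (map (\<lambda>(x, y). (of_int w - x, y)) R) = R"
    using P by (auto simp: sym_paths_def)
  have succ: "hd R - p \<in> dyck_steps K" "successively (\<lambda>p q. q - p \<in> dyck_steps K) R"
    using P'(3) R by (auto simp: successively_Cons successively_append_iff)
  then obtain c d where cd: "(c, d) \<in> double_steps K" "hd R - p = (of_int c / 2, d)"
    by (auto simp: dyck_steps_eq)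
  then have hd: "hd R = (of_int c / 2, h + d)"
    using P'(1) by (cases "hd R") (auto simp: minus_prod_def)
  have "last R = (\<lambda>(x, y). (of_int w - x, y)) (hd R)"
    using P'(5) R by (metis last_rev hd_map map_is_Nil_conv)
  then have last: "last R = (of_int w - of_int c / 2, h + d)" by (simp add: hd)
  define Q where "Q = map (translate (- of_int c / 2)) R"
  have "map (translate (of_int c / 2)) Q = R"
    by (simp add: Q_def translate_def o_def)
  then have "p # R @ [q] = surround w h c Q" by (simp add: surround_def P'(1,2))
  moreover have "Q \<in> sym_paths K (w - c) (h + d)"
  proof -
    have "rev (map (\<lambda>(x, y). (of_int (w - c) - x, y)) Q) =
        map (translate (- of_int c / 2)) (rev (map (\<lambda>(x, y). (of_int w - x, y)) R))"
      by (auto simp: Q_def rev_map translate_def field_simps)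
    then have "rev (map (\<lambda>(x, y). (of_int (w - c) - x, y)) Q) = Q"
      using P'(5) by (simp add: Q_def)
    moreover have "successively (\<lambda>p q. q - p \<in> dyck_steps K) Q"
      unfolding Q_def successively_translate by (rule succ(2))
    moreover have "hd Q = (0, h + d)" "last Q = (of_int (w - c), h + d)"
      using R hd last by (simp_all add: Q_def hd_map last_map translate_def)
    ultimately show ?thesis
      using P'(4) R by (auto simp: sym_paths_def Q_def translate_def)
  qed
  ultimately show ?thesis using that cd(1) by blast
qed

text \<open>With three or more vertices, the first and last steps are distinct and mirror each
  other. Shorter paths are a point or a single step, which is horizontal since both ends have the
  same height.\<close>

lemma sym_paths_eq:
  assumes h: "h \<ge> 0"
  shows "sym_paths K w h =
    (if w = 0 then {[(0, h)]} else {}) \<union>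
    (if 1 \<le> w \<and> w < int K then {[(0, h), (of_int w, h)]} else {}) \<union>
    (\<Union>(c, d) \<in> double_steps K. surround w h c ` sym_paths K (w - c) (h + d))"
    (is "_ = ?A \<union> ?B \<union> ?C")
proof (intro equalityI subsetI)
  fix P assume P: "P \<in> sym_paths K w h"
  then have "P \<noteq> []" by (simp add: sym_paths_def)
  then consider p where "P = [p]" | p q where "P = [p, q]"
    | p R q where "P = p # R @ [q]" "R \<noteq> []"
    by (metis append_Nil list.exhaust rev_exhaust)
  then show "P \<in> ?A \<union> ?B \<union> ?C"
  proof cases
    case 1
    then show ?thesis using P by (auto simp: sym_paths_def)
  next
    case 2
    then have "P = [(0, h), (of_int w, h)]" "(of_int w, 0) \<in> dyck_steps K"
      using P by (auto simp: sym_paths_def minus_prod_def)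
    then show ?thesis by (auto simp: dyck_steps_def)
  next
    case 3
    then obtain c d Q where "(c, d) \<in> double_steps K" "Q \<in> sym_paths K (w - c) (h + d)"
      "P = surround w h c Q"
      using sym_paths_surround P by metis
    then show ?thesis by blast
  qed
next
  fix P assume "P \<in> ?A \<union> ?B \<union> ?C"
  then consider "w = 0" "P = [(0, h)]" | "1 \<le> w" "w < int K" "P = [(0, h), (of_int w, h)]"
    | c d Q where "(c, d) \<in> double_steps K" "Q \<in> sym_paths K (w - c) (h + d)" "P = surround w h c Q"
    by (auto split: if_splits)
  then show "P \<in> sym_paths K w h"
  proof cases
    case 1
    then show ?thesis using h by (simp add: sym_paths_def)
  next
    case 2
    then have "(of_int w, 0) \<in> dyck_steps K"
      unfolding dyck_steps_def by (auto intro!: exI[of _ "nat w"])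
    then show ?thesis using 2 h by (auto simp: sym_paths_def minus_prod_def)
  next
    case 3
    then show ?thesis using surround_in_sym_paths h by blast
  qed
qed

lemma sym_paths_below: "h < 0 \<Longrightarrow> sym_paths K w h = {}"
  unfolding sym_paths_def using hd_in_set by fastforce

lemma sym_paths_negative_width:
  assumes "K > 0" "w < 0"
  shows "sym_paths K w h = {}"
proof -
  have "P \<notin> sym_paths K w h" if "w < 0" for P w h
    using that
  proof (induction "length P" arbitrary: P w h rule: less_induct)
    case less
    show ?case
    proof
      assume P: "P \<in> sym_paths K w h"
      then have "h \<ge> 0" by (metis empty_iff not_le sym_paths_below)
      from P[unfolded sym_paths_eq[OF this]] less.prems
      obtain c d Q where Q: "(c, d) \<in> double_steps K" "Q \<in> sym_paths K (w - c) (h + d)"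
        "P = surround w h c Q" by auto
      then have "w - c < 0" using less.prems by (auto simp: double_steps_def)
      moreover have "length Q < length P" by (simp add: Q(3) surround_def)
      ultimately show False using less.hyps Q(2) by blast
    qed
  qed
  then show ?thesis using assms(2) by blast
qed

lemma finite_double_steps: "finite (double_steps K)"
  by (simp add: double_steps_def)

lemma finite_sym_paths:
  assumes "K > 0"
  shows "finite (sym_paths K w h)"
proof (induction "nat (w + 1)" arbitrary: w h rule: less_induct)
  case less
  consider "w < 0 \<or> h < 0" | "w \<ge> 0" "h \<ge> 0" by linarith
  then show ?case
  proof cases
    case 1
    then show ?thesis using sym_paths_negative_width[OF assms] sym_paths_below by fastforce
  next
    case 2
    have "finite (sym_paths K (w - c) (h + d))" if "(c, d) \<in> double_steps K" for c d
      using that 2 assms by (intro less) (auto simp: double_steps_def)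
    then show ?thesis
      unfolding sym_paths_eq[OF 2(2)] using finite_double_steps by auto
  qed
qed

section \<open>Counting symmetric paths\<close>

definition num_paths :: "nat \<Rightarrow> int \<Rightarrow> int \<Rightarrow> int" where
  "num_paths K w h = int (card (sym_paths K w h))"

lemma inj_surround: "inj (surround w h c)"
proof -
  have "inj (translate a)" for a
    by (rule injI) (auto simp: translate_def prod_eq_iff)
  then show ?thesis
    unfolding surround_def by (intro injI) (simp add: inj_map_eq_map)
qed

lemma num_paths_rec:
  assumes K: "K > 0" and h: "h \<ge> 0"
  shows "num_paths K w h = (\<Sum>l = 1..<K. num_paths K (w - 2 * int l) h) +
    num_paths K (w - int K) (h + 1) + num_paths K (w - int K) (h - 1) +
    (if 0 \<le> w \<and> w < int K then 1 else 0)"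
proof -
  let ?A = "if w = 0 then {[(0, h)]} else {}"
  let ?B = "if 1 \<le> w \<and> w < int K then {[(0, h), (of_int w :: rat, h)]} else {}"
  define W where "W cd = surround w h (fst cd) ` sym_paths K (w - fst cd) (h + snd cd)" for cd
  have fin: "finite (W cd)" for cd using finite_sym_paths[OF K] by (simp add: W_def)
  \<comment> \<open>The second vertex reveals the first step, so the images for different steps are
    disjoint; having three vertices separates them from the short paths.\<close>
  have second: "P ! 1 = (of_int (fst cd) / 2, h + snd cd)" "length P \<ge> 3" if PW: "P \<in> W cd" for P cd
  proof -
    obtain Q where Q: "P = surround w h (fst cd) Q" "Q \<in> sym_paths K (w - fst cd) (h + snd cd)"
      using PW unfolding W_def by blast
    then have "Q \<noteq> []" "hd Q = (0, h + snd cd)" by (auto simp: sym_paths_def)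
    then show "P ! 1 = (of_int (fst cd) / 2, h + snd cd)" "length P \<ge> 3"
      by (cases Q; simp add: Q(1) surround_def translate_def)+
  qed
  have disj: "W cd \<inter> W cd' = {}" if "cd \<noteq> cd'" for cd cd'
  proof -
    have "(of_int (fst cd) / 2 :: rat, h + snd cd) \<noteq> (of_int (fst cd') / 2, h + snd cd')"
      using that by (auto simp: prod_eq_iff)
    then show ?thesis using second(1) by (metis disjoint_iff)
  qed
  have "sym_paths K w h = (?A \<union> ?B) \<union> (\<Union>cd \<in> double_steps K. W cd)"
    unfolding sym_paths_eq[OF h] W_def by (simp add: case_prod_beta)
  also have "card \<dots> = card (?A \<union> ?B) + card (\<Union>cd \<in> double_steps K. W cd)"
  proof (rule card_Un_disjoint)
    have "length P < 3" if "P \<in> ?A \<union> ?B" for P using that by (auto split: if_splits)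
    then show "(?A \<union> ?B) \<inter> (\<Union>cd \<in> double_steps K. W cd) = {}"
      using second(2) by (meson UN_E disjoint_iff not_le)
  qed (use fin finite_double_steps in auto)
  also have "card (?A \<union> ?B) = (if 0 \<le> w \<and> w < int K then 1 else 0)"
    using K by auto
  also have "card (\<Union>cd \<in> double_steps K. W cd) = (\<Sum>cd \<in> double_steps K. card (W cd))"
    using fin finite_double_steps disj by (intro card_UN_disjoint) auto
  finally have "num_paths K w h = (if 0 \<le> w \<and> w < int K then 1 else 0) +
      (\<Sum>cd \<in> double_steps K. int (card (W cd)))"
    by (simp add: num_paths_def)
  moreover have "int (card (W cd)) = num_paths K (w - fst cd) (h + snd cd)" for cd
    unfolding W_def num_paths_def by (simp add: card_image inj_on_subset[OF inj_surround])
  moreover have "(\<Sum>cd \<in> double_steps K. num_paths K (w - fst cd) (h + snd cd)) =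
      num_paths K (w - int K) (h + 1) + num_paths K (w - int K) (h - 1) +
      (\<Sum>l = 1..<K. num_paths K (w - 2 * int l) h)"
    unfolding double_steps_def
    by (subst sum.union_disjoint) (auto simp: sum.reindex inj_on_def)
  ultimately show ?thesis by simp
qed

text \<open>Reflection principle: the odd extension about height \<open>-1\<close> turns the recurrence for paths
  above the axis into one that is valid at all heights.\<close>

definition odd_paths :: "nat \<Rightarrow> int \<Rightarrow> int \<Rightarrow> int" where
  "odd_paths K w h = (if h \<ge> -1 then num_paths K w h else - num_paths K w (-2 - h))"

lemma num_paths_eq_0: "K > 0 \<Longrightarrow> w < 0 \<or> h < 0 \<Longrightarrow> num_paths K w h = 0"
  using sym_paths_below sym_paths_negative_width by (auto simp: num_paths_def)

text \<open>At height \<open>-1\<close> the contributions of heights \<open>0\<close> and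
  \<open>-2\<close> cancel; below it the recurrence is the negated mirror image of the one
  above.\<close>

lemma odd_paths_rec:
  assumes "K > 0"
  shows "odd_paths K w h = (\<Sum>l = 1..<K. odd_paths K (w - 2 * int l) h) +
    odd_paths K (w - int K) (h + 1) + odd_paths K (w - int K) (h - 1) +
    (if 0 \<le> w \<and> w < int K then sgn (h + 1) else 0)"
proof -
  have minus1: "num_paths K w' (-1) = 0" for w' using num_paths_eq_0[OF assms] by simp
  consider "h \<ge> 0" | "h = -1" | "h \<le> -2" by linarith
  then show ?thesis
  proof cases
    case 1
    then show ?thesis using num_paths_rec[OF assms 1, of w] by (simp add: odd_paths_def)
  next
    case 2
    then show ?thesis by (simp add: odd_paths_def minus1)
  next
    case 3
    have "odd_paths K w' h = - num_paths K w' (-2 - h)" for w'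
      using 3 by (simp add: odd_paths_def)
    moreover have "odd_paths K w' (h - 1) = - num_paths K w' (-2 - h + 1)" for w'
      using 3 by (simp add: odd_paths_def algebra_simps)
    moreover have "odd_paths K w' (h + 1) = - num_paths K w' (-2 - h - 1)" for w'
      using 3 minus1 by (cases "h = -2") (auto simp: odd_paths_def algebra_simps)
    ultimately show ?thesis
      using num_paths_rec[OF assms, of "-2 - h" w] 3 by (simp add: sum_negf)
  qed
qed

section \<open>Matching the two counts\<close>

text \<open>Differencing turns the source \<open>sgn (h + 1)\<close> into sources at heights
  \<open>0\<close> and \<open>-1\<close> only, which correspond to \<open>v = -1\<close> and
  \<open>v = -2\<close> in \<open>num_cont_rec\<close>.\<close>

definition diff_paths :: "nat \<Rightarrow> int \<Rightarrow> int \<Rightarrow> int" where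
  "diff_paths K w h = odd_paths K w h - odd_paths K w (h - 1)"

lemma diff_paths_rec:
  assumes "K > 0"
  shows "diff_paths K w h = (\<Sum>l = 1..<K. diff_paths K (w - 2 * int l) h) +
    diff_paths K (w - int K) (h + 1) + diff_paths K (w - int K) (h - 1) +
    (if 0 \<le> w \<and> w < int K \<and> (h = 0 \<or> h = -1) then 1 else 0)"
  unfolding diff_paths_def odd_paths_rec[OF assms, of w h] odd_paths_rec[OF assms, of w "h - 1"]
  by (auto simp: sum_subtractf sgn_if)

lemma diff_paths_negative_width: "K > 0 \<Longrightarrow> w < 0 \<Longrightarrow> diff_paths K w h = 0"
  by (simp add: diff_paths_def odd_paths_def num_paths_eq_0)

text \<open>Every term of the recurrence keeps \<open>n\<close> negative and has smaller width. A
  source would need \<open>v = -1\<close> or \<open>v = -2\<close>, where the width is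
  negative.\<close>

lemma diff_paths_eq_0:
  assumes K: "K > 0" and "n < 0"
  shows "diff_paths K (2 * n + (v + 1) * int K) (v + 1) = 0"
  using assms(2)
proof (induction "nat (2 * n + (v + 1) * int K + 1)" arbitrary: n v rule: less_induct)
  case less
  define w where "w = 2 * n + (v + 1) * int K"
  show ?case
  proof (cases "w < 0")
    case True
    then show ?thesis using diff_paths_negative_width[OF K] by (simp add: w_def)
  next
    case False
    have smaller: "diff_paths K w' (v' + 1) = 0"
      if "w' = 2 * n' + (v' + 1) * int K" "n' < 0" "w' < w" for w' n' v'
      using less.hyps[of n' v'] that False unfolding w_def[symmetric] that(1)[symmetric] by simp
    have "diff_paths K (w - 2 * int l) (v + 1) = 0" if "l \<in> {1..<K}" for l
      by (rule smaller[where n' = "n - int l"]) (use that less.prems in \<open>auto simp: w_def\<close>)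
    moreover have "diff_paths K (w - int K) (v + 1 + 1) = 0"
      by (rule smaller[where n' = "n - int K"]) (use K less.prems in \<open>auto simp: w_def algebra_simps\<close>)
    moreover have "diff_paths K (w - int K) (v - 1 + 1) = 0"
      by (rule smaller[where n' = n]) (use K less.prems in \<open>auto simp: w_def algebra_simps\<close>)
    moreover have "v \<noteq> -1" "v \<noteq> -2" using False less.prems by (auto simp: w_def)
    then have "v + 1 \<noteq> 0" "v + 1 \<noteq> -1" by linarith+
    ultimately show ?thesis
      unfolding w_def[symmetric] using diff_paths_rec[OF K, of w "v + 1"] by simp
  qed
qed

text \<open>Outer induction on \<open>n\<close>, inner induction upwards in \<open>v\<close>:
  \<open>num_cont_rec\<close> refers to smaller \<open>n\<close> and to the same \<open>n\<close> at
  \<open>v - 1\<close>.\<close>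

lemma num_cont_eq_diff_paths:
  "num_cont k n v = diff_paths (2 * k + 1) (2 * n + (v + 1) * int (2 * k + 1)) (v + 1)"
proof (induction "nat (n + 1)" arbitrary: n v rule: less_induct)
  case less
  define K where "K = 2 * k + 1"
  have K: "K > 0" by (simp add: K_def)
  have neg: "num_cont k n' v' = diff_paths K (2 * n' + (v' + 1) * int K) (v' + 1)"
    if "n' < 0" for n' v'
    using that diff_paths_eq_0[OF K that] by (simp add: num_cont_def)
  have prev: "num_cont k n' v' = diff_paths K (2 * n' + (v' + 1) * int K) (v' + 1)"
    if "n' < n" for n' v'
    using neg[of n' v'] less[of n' v'] that by (cases "n' < 0") (auto simp: K_def)
  have "num_cont k n v = diff_paths K (2 * n + (v + 1) * int K) (v + 1)"
  proof (cases "n < 0")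
    case n: False
    \<comment> \<open>Base of the inner induction: this far down the width is negative even for
      \<open>K = 1\<close>, and no admissible words exist.\<close>
    have low: "num_cont k n v = diff_paths K (2 * n + (v + 1) * int K) (v + 1)"
      if "v \<le> -3 - 2 * n" for v
    proof -
      have "(v + 1) * int K \<le> (-2 - 2 * n) * int K"
        using that by (intro mult_right_mono) auto
      also have "\<dots> \<le> (-2 - 2 * n) * 1"
        using n K by (intro mult_left_mono_neg) auto
      finally have "2 * n + (v + 1) * int K < 0" by simp
      then show ?thesis
        using that n by (simp add: diff_paths_negative_width[OF K] num_cont_eq_0)
    qed
    show ?thesis
    proof (cases "v \<le> -3 - 2 * n")
      case False
      then have "-3 - 2 * n \<le> v" by simp
      then show ?thesis
      proof (induction v rule: int_ge_induct)
        case base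
        show ?case by (rule low) simp
      next
        case (step v)
        \<comment> \<open>The width belonging to \<open>v + 1\<close>, whose height is
          \<open>v + 2\<close>. The arguments \<open>(n - l, v + 1)\<close>,
          \<open>(n - K, v + 2)\<close> and \<open>(n, v)\<close> have widths
          \<open>w - 2 * l\<close>, \<open>w - K\<close> and \<open>w - K\<close>.\<close>
        define w where "w = 2 * n + (v + 2) * int K"
        have "num_cont k (n - int l) (v + 1) = diff_paths K (w - 2 * int l) (v + 2)"
          if "l \<in> {1..2 * k}" for l
          using prev[of "n - int l" "v + 1"] that by (simp add: w_def algebra_simps)
        moreover have "num_cont k (n - int K) (v + 2) = diff_paths K (w - int K) (v + 3)"
          using prev[of "n - int K" "v + 2"] K by (simp add: w_def algebra_simps)
        moreover have "num_cont k n v = diff_paths K (w - int K) (v + 1)"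
          using step.IH by (simp add: w_def algebra_simps)
        moreover have "{1..<K} = {1..2 * k}" by (auto simp: K_def)
        moreover have "(0 \<le> w \<and> w < int K \<and> (v + 2 = 0 \<or> v + 2 = -1)) \<longleftrightarrow>
            v + 1 = -1 \<and> n \<le> int k \<or> v + 1 = -2 \<and> int k < n \<and> n \<le> 2 * int k"
        proof -
          consider "v = -2" | "v = -3" | "v + 2 \<noteq> 0" "v + 2 \<noteq> -1" by linarith
          then show ?thesis using n by cases (auto simp: w_def K_def)
        qed
        ultimately show ?case
          using num_cont_rec[of n k "v + 1"] diff_paths_rec[OF K, of w "v + 2"] n
          by (simp add: w_def K_def add.commute)
      qed
    qed (rule low)
  qed (rule neg)
  then show ?case by (simp add: K_def)
qed

theorem theorem2p27:
  fixes m k :: nat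
  assumes "m > 0"
  shows "finite (self_conjugate_cores {2 * m .. 2 * m + 2 * k + 1}) \<and>
         finite (symmetric_dyck_paths (2 * m) (2 * k + 1)) \<and>
         card (self_conjugate_cores {2 * m .. 2 * m + 2 * k + 1}) =
         card (symmetric_dyck_paths (2 * m) (2 * k + 1))"
proof -
  let ?T = "{2 * m..2 * m + (2 * k + 1)}"
  let ?L = "{xs. length xs = m \<and> admissible k (-1) 0 xs}"
  have cores: "bij_betw maya (self_conjugate_cores ?T) (symmetric_maya ?T)"
    using assms by (intro bij_betw_maya) auto
  note profiles = bij_betw_profiles_maya[OF assms, of "2 * k + 1"]
  note words = bij_betw_profiles_admissible[OF assms, of k]
  have "finite ?L" by (rule finite_admissible)
  then have "finite (self_conjugate_cores ?T)"
    using bij_betw_finite[OF cores] bij_betw_finite[OF profiles] bij_betw_finite[OF words] by blast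
  moreover have "card (self_conjugate_cores ?T) = card ?L"
    using bij_betw_same_card[OF cores] bij_betw_same_card[OF profiles] bij_betw_same_card[OF words]
    by simp
  \<comment> \<open>For \<open>n = m\<close> and \<open>v = -1\<close> the width is
    \<open>2 * m\<close> and the height \<open>0\<close>; the subtracted count at height
    \<open>-1\<close> vanishes.\<close>
  moreover have "int (card ?L) = int (card (symmetric_dyck_paths (2 * m) (2 * k + 1)))"
    using num_cont_eq_diff_paths[of k "int m" "-1"] num_paths_eq_0[of "2 * k + 1" "2 * int m" "-1"]
    unfolding symmetric_dyck_paths_eq
    by (simp add: num_cont_def num_admissible_def diff_paths_def odd_paths_def num_paths_def)
  moreover have "finite (symmetric_dyck_paths (2 * m) (2 * k + 1))"
    unfolding symmetric_dyck_paths_eq by (rule finite_sym_paths) simp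
  ultimately show ?thesis by (simp add: add.assoc)
qed

end
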